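(* Let $r\ge 1$ and let $\mathcal F$ be the set of front faces of $[0,1]^r$. Let $a\colon\mathcal F\to(0,\infty)$ and $b\colon\mathcal F\to[0,\infty)$ be maps such that $(a(F),b(F))=(1,\dim F)$ for all $F\in\mathcal F$ with $\dim F\le 1$. Assume that $b$ is increasing. Then there exists a copula measure $c$ on $[0,1]^r$ with $\operatorname{tchar}_c=(a,b)$ such that $c$ is locally piecewise uniform on $(0,1)^r$.
   Context: A front face of $[0,1]^r$ is a face containing the origin, i.e. a set $F(\nu)=\{u\in[0,1]^r : u_i=0 \text{ if } \nu_i=0\}$ with $\nu\in\{0,1\}^r$; $\dim F(\nu)=\sum_i\nu_i$. Each front face $F$ is identified with $[0,1]^{\dim F}$. A map $b\colon\mathcal F\to\mathbb R$ is increasing if $b(F)<b(F')$ whenever $F\subset F'$, $F\ne F'$. A copula measure on $[0,1]^r$ is a Borel probability measure whose push-forward to every $1$-dimensional front face (under the coordinate projection) is the uniform probability measure. For a Borel probability measure $c$ on $[0,1]^d$ put (with $s\in(0,1]$) $$\operatorname{td}(c)=\inf\Big\{\tau\in\mathbb R : \liminf_{s\to0}\frac{c(s\cdot[0,1]^d)}{s^\tau}=\infty\Big\},\qquad \operatorname{tc}(c)=\liminf_{s\to 0}\frac{c(s\cdot[0,1]^d)}{s^{\operatorname{td}(c)}}\ \text{ if }\operatorname{td}(c)<\infty,$$ and $\operatorname{tc}(c)=0$ if $\operatorname{td}(c)=\infty$. For a copula measure $c$ on $[0,1]^r$ and $F\in\mathcal F$ let $c_F$ be the push-forward of $c$ under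 the canonical coordinate projection $[0,1]^r\to F$. The tail characteristic is the map $\operatorname{tchar}_c=(\operatorname{tcoef}_c,\operatorname{tdeg}_c)$ on $\mathcal F$ with $\operatorname{tcoef}_c(F)=\operatorname{tc}(c_F)$ and $\operatorname{tdeg}_c(F)=\operatorname{td}(c_F)$. A box measure on $[0,1]^r$ is a signed measure for which there is a decomposition of $[0,1]^r$ into finitely many compact boxes (products of compact intervals of positive length) with pairwise disjoint interiors such that the measure restricted to each box is a constant multiple of Lebesgue measure. A probability measure $c$ on $[0,1]^r$ is locally piecewise uniform on $E\subset[0,1]^r$ if each $w\in E$ has a neighbourhood $W$ in $[0,1]^r$ such that $c|_W$ equals the restriction to $W$ of some box measure. *)

theory Defs
  imports "HOL-Probability.Probability"
begin

abbreviation unit_cube :: "(real ^ 'r) set" where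
  "unit_cube \<equiv> cbox 0 1"

(* The parameter N is {i. \<nu> i = 1}; r = CARD('r). *)
definition front_face :: "'r set \<Rightarrow> (real ^ 'r) set" where
  "front_face N = {u \<in> unit_cube. \<forall>i. i \<notin> N \<longrightarrow> u $ i = 0}"

definition front_faces :: "(real ^ 'r) set set" where
  "front_faces = range front_face"

(* Recovers N from front_face N, see face_support_front_face below. *)
definition face_support :: "(real ^ 'r) set \<Rightarrow> 'r set" where
  "face_support F = {i. \<exists>u\<in>F. u $ i \<noteq> 0}"

definition face_dim :: "(real ^ 'r) set \<Rightarrow> nat" where
  "face_dim F = card (face_support F)"

definition face_proj :: "(real ^ 'r) set \<Rightarrow> real ^ 'r \<Rightarrow> real ^ 'r" where
  "face_proj F u = (\<chi> i. if i \<in> face_support F then u $ i else 0)"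

definition borel_prob_measure_on :: "'a::topological_space set \<Rightarrow> 'a measure \<Rightarrow> bool" where
  "borel_prob_measure_on X c \<longleftrightarrow> prob_space c \<and> space c = X \<and> sets c = sets (restrict_space borel X)"

(* The push-forward c_F is kept as a measure on the face F itself; the identification of F
   with a cube of dimension face_dim F is linear, so it turns the scaled cube into
   the image of F under scaling by s. *)
definition face_marginal :: "(real ^ 'r) set \<Rightarrow> (real ^ 'r) measure \<Rightarrow> (real ^ 'r) measure" where
  "face_marginal F c = distr c (restrict_space borel F) (face_proj F)"

(* The map t \<mapsto> axis i t is the identification of the unit interval with the i-th
   one-dimensional front face. *)
definition copula_measure :: "(real ^ 'r) measure \<Rightarrow> bool" where
  "copula_measure c \<longleftrightarrow>
     borel_prob_measure_on unit_cube c \<and>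
     (\<forall>i. face_marginal (front_face {i}) c =
        distr (restrict_space lborel {0..1}) (restrict_space borel (front_face {i})) (axis i))"

(* Here space c is a unit cube, or a front face identified with one. *)
definition corner_mass :: "'a::real_vector measure \<Rightarrow> real \<Rightarrow> real" where
  "corner_mass c s = measure c ((\<lambda>u. s *\<^sub>R u) ` space c)"

(* Extended reals, so that the infimum of the empty set is \<infinity>. *)
definition td :: "'a::real_vector measure \<Rightarrow> ereal" where
  "td c = Inf {ereal \<tau> | \<tau>. Liminf (at_right 0) (\<lambda>s. ereal (corner_mass c s / s powr \<tau>)) = \<infinity>}"

definition tc :: "'a::real_vector measure \<Rightarrow> ereal" where
  "tc c = (if td c < \<infinity>
           then Liminf (at_right 0) (\<lambda>s. ereal (corner_mass c s / s powr real_of_ereal (td c)))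
           else 0)"

definition tcoef :: "(real ^ 'r) measure \<Rightarrow> (real ^ 'r) set \<Rightarrow> ereal" where
  "tcoef c F = tc (face_marginal F c)"

definition tdeg :: "(real ^ 'r) measure \<Rightarrow> (real ^ 'r) set \<Rightarrow> ereal" where
  "tdeg c F = td (face_marginal F c)"

definition tchar :: "(real ^ 'r) measure \<Rightarrow> (real ^ 'r) set \<Rightarrow> ereal \<times> ereal" where
  "tchar c F = (tcoef c F, tdeg c F)"

definition signed_measure :: "'a measure \<Rightarrow> ('a set \<Rightarrow> real) \<Rightarrow> bool" where
  "signed_measure M \<mu> \<longleftrightarrow>
     \<mu> {} = 0 \<and>
     (\<forall>A :: nat \<Rightarrow> 'a set. range A \<subseteq> sets M \<longrightarrow> disjoint_family A \<longrightarrow>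
        (\<lambda>n. \<mu> (A n)) sums \<mu> (\<Union>n. A n))"

definition box_measure :: "((real ^ 'r) set \<Rightarrow> real) \<Rightarrow> bool" where
  "box_measure \<mu> \<longleftrightarrow>
     signed_measure (restrict_space borel unit_cube) \<mu> \<and>
     (\<exists>D. D division_of unit_cube \<and>
        (\<forall>B\<in>D. \<exists>l u. B = cbox l u \<and> (\<forall>i. l $ i < u $ i)) \<and>
        (\<forall>B\<in>D. \<exists>k::real. \<forall>A\<in>sets borel. A \<subseteq> B \<longrightarrow> \<mu> A = k * measure lborel A))"

definition locally_piecewise_uniform_on :: "(real ^ 'r) set \<Rightarrow> (real ^ 'r) measure \<Rightarrow> bool" where
  "locally_piecewise_uniform_on E c \<longleftrightarrow>
     (\<forall>w\<in>E. \<exists>W\<in>sets c. \<exists>\<mu>.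
        (\<exists>U. openin (top_of_set unit_cube) U \<and> w \<in> U \<and> U \<subseteq> W) \<and>
        box_measure \<mu> \<and>
        (\<forall>A\<in>sets c. A \<subseteq> W \<longrightarrow> measure c A = \<mu> A))"

lemma face_support_front_face: "face_support (front_face N) = N"
proof
  show "face_support (front_face N) \<subseteq> N"
    by (auto simp: face_support_def front_face_def)
  show "N \<subseteq> face_support (front_face N)"
  proof
    fix i assume "i \<in> N"
    then have "(\<chi> j. if j \<in> N then 1 else 0) \<in> front_face N"
      by (auto simp: front_face_def mem_box_cart)
    with \<open>i \<in> N\<close> show "i \<in> face_support (front_face N)"
      unfolding face_support_def by (auto intro!: bexI[of _ "\<chi> j. if j \<in> N then 1 else 0"])
  qed
qed

lemma face_dim_front_face: "face_dim (front_face N) = card N"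
  by (simp add: face_dim_def face_support_front_face)

lemma face_proj_front_face:
  "u \<in> unit_cube \<Longrightarrow> face_proj (front_face N) u \<in> front_face N"
  unfolding face_proj_def face_support_front_face by (auto simp: front_face_def mem_box_cart)

lemma measurable_face_proj:
  fixes N :: "'r::finite set"
  assumes "borel_prob_measure_on unit_cube c"
  shows "face_proj (front_face N) \<in> measurable c (restrict_space borel (front_face N))"
proof (rule measurable_restrict_space2)
  show "face_proj (front_face N) \<in> space c \<rightarrow> front_face N"
    using assms by (auto simp: borel_prob_measure_on_def intro: face_proj_front_face)
  have "continuous_on UNIV (face_proj (front_face N))"
    unfolding face_proj_def
  proof (rule continuous_on_vec_lambda)
    show "continuous_on UNIV (\<lambda>u::real^'r. if i \<in> face_support (front_face N) then u $ i else 0)" for i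
      by (cases "i \<in> face_support (front_face N)") (auto intro: continuous_intros)
  qed
  then have "face_proj (front_face N) \<in> measurable (restrict_space borel unit_cube) borel"
    by (intro measurable_restrict_space1 borel_measurable_continuous_onI)
  then show "face_proj (front_face N) \<in> measurable c borel"
    using assms measurable_cong_sets[of c "restrict_space borel unit_cube" borel borel]
    by (auto simp: borel_prob_measure_on_def)
qed

lemma measurable_axis_front_face:
  fixes i :: "'r::finite"
  shows "axis i \<in> measurable (restrict_space lborel {0..1::real}) (restrict_space borel (front_face {i}))"
proof (rule measurable_restrict_space2)
  show "axis i \<in> space (restrict_space lborel {0..1::real}) \<rightarrow> front_face {i}"
    by (auto simp: front_face_def mem_box_cart axis_def space_restrict_space)
  have "axis i = (\<lambda>t::real. t *\<^sub>R axis i (1::real))"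
    by (auto simp: fun_eq_iff vec_eq_iff axis_def)
  moreover have "continuous_on UNIV (\<lambda>t::real. t *\<^sub>R axis i (1::real))"
    by (intro continuous_intros)
  ultimately have "(axis i :: real \<Rightarrow> real ^ 'r) \<in> borel_measurable borel"
    by (metis borel_measurable_continuous_onI)
  then show "(axis i :: real \<Rightarrow> real ^ 'r) \<in> measurable (restrict_space lborel {0..1}) borel"
    by (intro measurable_restrict_space1) simp
qed

end

theory Submission imports Defs "HOL-Real_Asymp.Real_Asymp" begin

text \<open>Split \<open>{0<..1}\<close> into \<open>{\<epsilon><..1}\<close> and the shells \<open>{\<epsilon> / 2 ^ Suc k<..\<epsilon> / 2 ^ k}\<close>. For every set \<open>N\<close> of
  at least two coordinates and every \<open>k\<close>, put mass \<open>P N * (\<epsilon> / 2 ^ k) powr b N\<close> uniformly on the product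
  of \<open>k\<close>-th shells in the coordinates in \<open>N\<close> and of \<open>{\<epsilon><..1}\<close> in the others. As \<open>b N > 1\<close>, this mass is
  negligible compared with the length of the shell, so the marginals can be completed to uniform ones by
  masses with \<open>card N \<le> 1\<close>, which do not touch the corners in two or more coordinates. The corner of side
  \<open>s\<close> in the coordinates in \<open>N\<close> only receives mass from sets \<open>M \<supseteq> N\<close>, of order \<open>s powr b M\<close>; since \<open>b\<close> is
  strictly increasing, \<open>M = N\<close> dominates, and \<open>P N\<close> is chosen to match the tail coefficient. The shells
  accumulate only at the boundary of the cube, so the measure is piecewise uniform locally in its interior.\<close>

section \<open>Tail degree and tail coefficient\<close>

text \<open>Testing against real thresholds covers infinite limits inferior too. One inequality is
  enough, because perturbing back by \<open>- e\<close> gives the other.\<close>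

lemma Liminf_le_Liminf_add_tendsto_0:
  fixes f e :: "'a \<Rightarrow> real"
  assumes "(e \<longlongrightarrow> 0) F"
  shows "Liminf F (\<lambda>x. ereal (f x)) \<le> Liminf F (\<lambda>x. ereal (f x + e x))"
  unfolding le_Liminf_iff
proof (intro allI impI)
  fix y assume y: "y < Liminf F (\<lambda>x. ereal (f x))"
  then obtain z where z: "y < ereal z" "ereal z < Liminf F (\<lambda>x. ereal (f x))"
    using ereal_dense2 by blast
  from z(2) have ev: "\<forall>\<^sub>F x in F. z < f x"
    using less_LiminfD by fastforce
  show "\<forall>\<^sub>F x in F. y < ereal (f x + e x)"
  proof (cases y)
    case (real t)
    then have "\<forall>\<^sub>F x in F. \<bar>e x\<bar> < z - t"
      using assms z(1) by (auto dest: tendstoD[where e="z - t"] simp: dist_real_def)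
    with ev show ?thesis
      by eventually_elim (use real in auto)
  qed (use z in auto)
qed

lemma Liminf_add_tendsto_0:
  fixes f e :: "'a \<Rightarrow> real"
  assumes "(e \<longlongrightarrow> 0) F"
  shows "Liminf F (\<lambda>x. ereal (f x + e x)) = Liminf F (\<lambda>x. ereal (f x))"
proof (rule antisym)
  have "((\<lambda>x. - e x) \<longlongrightarrow> 0) F"
    using tendsto_minus[OF assms] by simp
  from Liminf_le_Liminf_add_tendsto_0[OF this, of "\<lambda>x. f x + e x"]
  show "Liminf F (\<lambda>x. ereal (f x + e x)) \<le> Liminf F (\<lambda>x. ereal (f x))"
    by simp
qed (rule Liminf_le_Liminf_add_tendsto_0[OF assms])

text \<open>A finite positive limit inferior fixes the critical exponent. For
  \<open>\<tau> > \<beta>\<close> the ratio dominates a multiple of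
  \<open>s powr (\<beta> - \<tau>)\<close>, which tends to infinity. For
  \<open>\<tau> \<le> \<beta>\<close> and \<open>s < 1\<close> it is at most the ratio at
  \<open>\<beta>\<close>, so its limit inferior stays below infinity. The exponents in the
  definition of \<open>td\<close> therefore form the open ray above \<open>\<beta>\<close>.\<close>

lemma td_tc_eqI:
  fixes c :: "'a::real_vector measure"
  assumes lim: "Liminf (at_right 0) (\<lambda>s. ereal (corner_mass c s / s powr \<beta>)) = ereal \<alpha>" and "0 < \<alpha>"
  shows "td c = ereal \<beta>" "tc c = ereal \<alpha>"
proof -
  let ?g = "corner_mass c"
  have infty: "Liminf (at_right 0) (\<lambda>s. ereal (?g s / s powr \<tau>)) = \<infinity>" if "\<beta> < \<tau>" for \<tau>
  proof -
    have ev: "\<forall>\<^sub>F s in at_right 0. ereal (\<alpha> / 2) < ereal (?g s / s powr \<beta>)"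
      using \<open>0 < \<alpha>\<close> by (intro less_LiminfD) (simp add: lim)
    have "filterlim (\<lambda>s::real. \<alpha> / 2 * s powr (\<beta> - \<tau>)) at_top (at_right 0)"
      using \<open>0 < \<alpha>\<close> that by real_asymp
    moreover have "\<forall>\<^sub>F s in at_right 0. \<alpha> / 2 * s powr (\<beta> - \<tau>) \<le> ?g s / s powr \<tau>"
      using ev eventually_at_right_less[of 0]
    proof eventually_elim
      case (elim s)
      then have "\<alpha> / 2 * s powr (\<beta> - \<tau>) \<le> ?g s / s powr \<beta> * s powr (\<beta> - \<tau>)"
        by (intro mult_right_mono) auto
      also have "\<dots> = ?g s / s powr \<tau>"
        using elim by (simp add: powr_diff)
      finally show ?case .
    qed
    ultimately have "filterlim (\<lambda>s. ?g s / s powr \<tau>) at_top (at_right 0)"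
      by (rule filterlim_at_top_mono)
    then show ?thesis
      by (intro lim_imp_Liminf) (simp_all add: tendsto_PInfty_eq_at_top)
  qed
  have "\<beta> < \<tau>" if "Liminf (at_right 0) (\<lambda>s. ereal (?g s / s powr \<tau>)) = \<infinity>" for \<tau>
  proof (rule ccontr)
    assume "\<not> \<beta> < \<tau>"
    have "\<forall>\<^sub>F s::real in at_right 0. 0 < s \<and> s < 1"
      using eventually_at_right_less[of 0] eventually_at_right_real[of 0 1]
      by (auto elim: eventually_mono)
    then have "\<forall>\<^sub>F s in at_right 0. ereal (?g s / s powr \<tau>) \<le> ereal (?g s / s powr \<beta>)"
    proof eventually_elim
      case (elim s)
      then have "s powr \<beta> \<le> s powr \<tau>"
        using \<open>\<not> \<beta> < \<tau>\<close> by (intro powr_mono') auto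
      then show ?case
        using elim by (auto simp: corner_mass_def intro!: divide_left_mono)
    qed
    from Liminf_mono[OF this] show False
      using that lim by simp
  qed
  with infty have "{ereal \<tau> | \<tau>. Liminf (at_right 0) (\<lambda>s. ereal (?g s / s powr \<tau>)) = \<infinity>} = ereal ` {\<beta><..}"
    by auto
  moreover have "Inf (ereal ` {\<beta><..}) = ereal \<beta>"
  proof (rule antisym)
    show "Inf (ereal ` {\<beta><..}) \<le> ereal \<beta>"
    proof (rule dense_ge)
      fix y assume "ereal \<beta> < y"
      then obtain z where "\<beta> < z" "ereal z < y"
        using ereal_dense2 by (metis ereal_less(2) less_ereal.simps(1))
      then show "Inf (ereal ` {\<beta><..}) \<le> y"
        by (intro INF_lower2[of z]) auto
    qed
  qed (auto intro: Inf_greatest)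
  ultimately show td: "td c = ereal \<beta>"
    by (simp add: td_def)
  show "tc c = ereal \<alpha>"
    using lim by (simp add: tc_def td)
qed

section \<open>Dyadic shells\<close>

lemma emeasure_lborel_product_cart:
  fixes X :: "'r::finite \<Rightarrow> real set"
  assumes [measurable]: "\<And>i. X i \<in> sets borel"
  shows "emeasure lborel {u :: real^'r. \<forall>i. u $ i \<in> X i} = (\<Prod>i\<in>UNIV. emeasure lborel (X i))"
proof -
  \<comment> \<open>The product formula for \<open>lborel\<close> runs over \<open>Basis\<close>;
    \<open>idx\<close> turns a basis vector back into its coordinate.\<close>
  define idx :: "real^'r \<Rightarrow> 'r" where "idx b = (THE i. b = axis i 1)" for b
  have idx: "idx (axis i 1) = i" for i
    unfolding idx_def by (auto simp: axis_eq_axis)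
  have Basis: "(Basis :: (real^'r) set) = (\<lambda>i. axis i 1) ` UNIV"
    by (auto simp: Basis_vec_def)
  have inj: "inj (\<lambda>i::'r. axis i (1::real))"
    by (auto intro!: injI simp: axis_eq_axis)
  have reindex: "(\<Prod>b\<in>(Basis :: (real^'r) set). g b) = (\<Prod>i\<in>UNIV. g (axis i 1))" for g :: "_ \<Rightarrow> ennreal"
    unfolding Basis by (subst prod.reindex[OF inj]) simp
  have "{u :: real^'r. \<forall>i. u $ i \<in> X i} \<in> sets borel"
    by measurable
  then have "emeasure lborel {u :: real^'r. \<forall>i. u $ i \<in> X i}
      = (\<integral>\<^sup>+u. indicator {u. \<forall>i. u $ i \<in> X i} u \<partial>lborel)"
    by simp
  also have "\<dots> = (\<integral>\<^sup>+u. (\<Prod>b\<in>Basis. indicator (X (idx b)) (u \<bullet> b)) \<partial>(lborel :: (real^'r) measure))"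
    unfolding reindex idx
    by (intro nn_integral_cong)
       (auto simp: inner_axis indicator_def cong: prod.cong)
  also have "\<dots> = (\<Prod>b\<in>(Basis :: (real^'r) set). \<integral>\<^sup>+x. indicator (X (idx b)) x \<partial>lborel)"
    by (intro nn_integral_lborel_prod) auto
  also have "\<dots> = (\<Prod>i\<in>UNIV. emeasure lborel (X i))"
    unfolding reindex idx by simp
  finally show ?thesis .
qed

definition shell :: "real \<Rightarrow> nat \<Rightarrow> real set" where
  "shell \<epsilon> k = {\<epsilon> / 2 ^ Suc k <.. \<epsilon> / 2 ^ k}"

lemma measure_shell: "0 < \<epsilon> \<Longrightarrow> measure lborel (shell \<epsilon> k) = \<epsilon> / 2 ^ Suc k"
  by (simp add: shell_def field_simps)

lemma sets_shell [measurable]: "shell \<epsilon> k \<in> sets borel"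
  by (simp add: shell_def)

lemma shell_unique:
  assumes "0 < \<epsilon>" "x \<in> shell \<epsilon> j" "x \<in> shell \<epsilon> k"
  shows "j = k"
proof -
  have *: False if "j < k" "x \<in> shell \<epsilon> j" "x \<in> shell \<epsilon> k" for j k
  proof -
    have "x \<le> \<epsilon> / 2 ^ k"
      using that by (simp add: shell_def)
    also have "\<dots> \<le> \<epsilon> / 2 ^ Suc j"
      using \<open>0 < \<epsilon>\<close> \<open>j < k\<close> by (intro divide_left_mono power_increasing) auto
    finally show False
      using that by (simp add: shell_def)
  qed
  show ?thesis
    using *[of j k] *[of k j] assms by (meson linorder_neqE_nat)
qed

lemma disjoint_family_shell: "0 < \<epsilon> \<Longrightarrow> disjoint_family (shell \<epsilon>)"
  by (auto simp: disjoint_family_on_def dest: shell_unique)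

lemma shell_exists:
  assumes "0 < s" "s \<le> \<epsilon>"
  shows "\<exists>k. s \<in> shell \<epsilon> k"
proof -
  define P where "P k \<longleftrightarrow> \<epsilon> / 2 ^ k < s" for k
  have "(\<lambda>k. \<epsilon> / 2 ^ k) \<longlonglongrightarrow> 0"
    by real_asymp
  then have "\<forall>\<^sub>F k in sequentially. P k"
    unfolding P_def using assms by (intro order_tendstoD) auto
  then have "\<exists>k. P k"
    by (auto simp: eventually_sequentially)
  then obtain n where "P n" ..
  moreover have "\<not> P 0"
    using assms by (simp add: P_def)
  \<comment> \<open>Since \<open>s \<le> \<epsilon>\<close> excludes \<open>P 0\<close>, the least
    index satisfying \<open>P\<close> is a successor, and its predecessor is the shell that contains
    \<open>s\<close>.\<close>
  ultimately obtain k where "\<forall>i\<le>k. \<not> P i" "P (Suc k)"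
    using ex_least_nat_less[of P n] by blast
  then have "\<not> P k" "P (Suc k)"
    by simp_all
  then show ?thesis
    unfolding P_def shell_def by (intro exI[of _ k]) simp
qed

lemma UN_shell: "0 < \<epsilon> \<Longrightarrow> (\<Union>k. shell \<epsilon> k) = {0<..\<epsilon>}"
proof safe
  fix x k assume "0 < \<epsilon>" "x \<in> shell \<epsilon> k"
  then have "\<epsilon> / 2 ^ Suc k < x" "x \<le> \<epsilon> / 2 ^ k" "0 < \<epsilon> / 2 ^ Suc k" "\<epsilon> / 2 ^ k \<le> \<epsilon>"
    using divide_left_mono[of 1 "2^k" \<epsilon>] by (auto simp: shell_def)
  then have "0 < x" "x \<le> \<epsilon>"
    by linarith+
  then show "x \<in> {0<..\<epsilon>}"
    by simp
qed (use shell_exists in fastforce)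

section \<open>Truncated shells and their weighted power sums\<close>

definition shell_part :: "real \<Rightarrow> nat \<Rightarrow> real \<Rightarrow> real" where
  "shell_part \<epsilon> k s = measure lborel ({..s} \<inter> shell \<epsilon> k) / measure lborel (shell \<epsilon> k)"

lemma shell_part_nonneg: "0 \<le> shell_part \<epsilon> k s"
  by (simp add: shell_part_def)

lemma shell_part_le_1: "shell_part \<epsilon> k s \<le> 1"
proof -
  have "emeasure lborel (shell \<epsilon> k) < \<infinity>"
    by (rule emeasure_bounded_finite) (simp add: shell_def)
  then have "measure lborel ({..s} \<inter> shell \<epsilon> k) \<le> measure lborel (shell \<epsilon> k)"
    by (intro measure_mono_fmeasurable) (auto simp: fmeasurable_def)
  then show ?thesis
    using measure_nonneg[of lborel "shell \<epsilon> k"]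
    unfolding shell_part_def divide_le_eq_1 by linarith
qed

lemma shell_part_eq_1:
  assumes "0 < \<epsilon>" "\<epsilon> / 2 ^ k \<le> s"
  shows "shell_part \<epsilon> k s = 1"
proof -
  have "{..s} \<inter> shell \<epsilon> k = shell \<epsilon> k"
    using assms by (auto simp: shell_def)
  then show ?thesis
    using assms by (simp add: shell_part_def measure_shell)
qed

lemma shell_part_eq_0:
  assumes "s \<le> \<epsilon> / 2 ^ Suc k"
  shows "shell_part \<epsilon> k s = 0"
proof -
  have "{..s} \<inter> shell \<epsilon> k = {}"
    using assms by (auto simp: shell_def)
  then show ?thesis
    by (simp add: shell_part_def)
qed

text \<open>As \<open>shell_part\<close> is the distribution function of the uniform law on a shell,
  this is the mass of the corner of side \<open>s\<close> in \<open>n\<close> coordinates, when the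
  \<open>n\<close>-fold product of the \<open>k\<close>-th shell carries mass
  \<open>(\<epsilon> / 2 ^ k) powr \<beta>\<close> uniformly.\<close>

definition shell_sum :: "real \<Rightarrow> real \<Rightarrow> nat \<Rightarrow> real \<Rightarrow> real" where
  "shell_sum \<epsilon> \<beta> n s = (\<Sum>k. (\<epsilon> / 2 ^ k) powr \<beta> * shell_part \<epsilon> k s ^ n)"

lemma shell_powr:
  fixes \<epsilon> \<beta> :: real
  assumes "0 < \<epsilon>"
  shows "(\<epsilon> / 2 ^ k) powr \<beta> = \<epsilon> powr \<beta> * (1 / 2 powr \<beta>) ^ k"
proof -
  have "(2 ^ k) powr \<beta> = (2 powr \<beta>) ^ k"
    by (simp add: powr_powr mult.commute flip: powr_realpow)
  with assms show ?thesis
    by (simp add: powr_divide power_one_over)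
qed

lemma summable_shell_powr:
  fixes \<epsilon> \<beta> :: real
  assumes "0 < \<epsilon>" "0 < \<beta>"
  shows "summable (\<lambda>k. (\<epsilon> / 2 ^ k) powr \<beta>)"
  unfolding shell_powr[OF \<open>0 < \<epsilon>\<close>] using \<open>0 < \<beta>\<close>
  by (intro summable_mult summable_geometric) (auto intro: gr_one_powr)

lemma summable_shell_sum:
  assumes "0 < \<epsilon>" "0 < \<beta>"
  shows "summable (\<lambda>k. (\<epsilon> / 2 ^ k) powr \<beta> * shell_part \<epsilon> k s ^ n)"
proof (rule summable_comparison_test'[OF summable_shell_powr[OF assms]])
  show "norm ((\<epsilon> / 2 ^ k) powr \<beta> * shell_part \<epsilon> k s ^ n) \<le> (\<epsilon> / 2 ^ k) powr \<beta>" for k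
    using power_le_one[OF shell_part_nonneg shell_part_le_1, of \<epsilon> k s n]
    by (simp add: shell_part_nonneg mult_left_le)
qed

text \<open>If \<open>s\<close> lies in the \<open>k\<close>-th shell, the next shell lies entirely
  below \<open>s\<close> and its right end is at least \<open>s / 2\<close>; its term alone gives
  the bound.\<close>

lemma shell_sum_lower:
  assumes "0 < s" "s \<le> \<epsilon>" "0 < \<beta>"
  shows "(s / 2) powr \<beta> \<le> shell_sum \<epsilon> \<beta> n s"
proof -
  have "0 < \<epsilon>" using assms by simp
  obtain k where k: "s \<in> shell \<epsilon> k"
    using shell_exists assms by blast
  then have "\<epsilon> / 2 ^ Suc k \<le> s" "s / 2 \<le> \<epsilon> / 2 ^ Suc k"
    by (auto simp: shell_def)
  then have "(s / 2) powr \<beta> \<le> (\<epsilon> / 2 ^ Suc k) powr \<beta> * shell_part \<epsilon> (Suc k) s ^ n"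
    using assms by (subst shell_part_eq_1) (auto intro: powr_mono2)
  also have "\<dots> \<le> shell_sum \<epsilon> \<beta> n s"
    using sum_le_suminf[OF summable_shell_sum[of \<epsilon> \<beta> s n], of "{Suc k}"] assms \<open>0 < \<epsilon>\<close>
    by (simp add: shell_sum_def shell_part_nonneg)
  finally show ?thesis .
qed

text \<open>If \<open>s\<close> lies in the \<open>k\<close>-th shell, the earlier shells lie above
  \<open>s\<close>, and their terms vanish because \<open>0 < n\<close>. The remaining terms are
  dominated by a geometric series with first term \<open>(\<epsilon> / 2 ^ k) powr \<beta>\<close>,
  where \<open>\<epsilon> / 2 ^ k \<le> 2 * s\<close>.\<close>

lemma shell_sum_upper:
  assumes "0 < s" "s \<le> \<epsilon>" "0 < \<beta>" "0 < n"
  shows "shell_sum \<epsilon> \<beta> n s \<le> 2 powr \<beta> / (1 - 1 / 2 powr \<beta>) * s powr \<beta>"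
proof -
  have "0 < \<epsilon>" using assms by simp
  obtain k where k: "s \<in> shell \<epsilon> k"
    using shell_exists assms by blast
  let ?f = "\<lambda>j. (\<epsilon> / 2 ^ j) powr \<beta> * shell_part \<epsilon> j s ^ n"
  have le: "?f j \<le> (\<epsilon> / 2 ^ j) powr \<beta>" for j
    using power_le_one[OF shell_part_nonneg shell_part_le_1, of \<epsilon> j s n]
    by (simp add: shell_part_nonneg mult_left_le)
  have zero: "?f j = 0" if "j < k" for j
  proof -
    have "s \<le> \<epsilon> / 2 ^ k"
      using k by (simp add: shell_def)
    also have "\<dots> \<le> \<epsilon> / 2 ^ Suc j"
      using \<open>0 < \<epsilon>\<close> that by (intro divide_left_mono power_increasing) auto
    finally show ?thesis
      using shell_part_eq_0 \<open>0 < n\<close> by simp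
  qed
  have one: "1 / 2 powr \<beta> < 1"
    using \<open>0 < \<beta>\<close> by (simp add: gr_one_powr)
  have "shell_sum \<epsilon> \<beta> n s = (\<Sum>j. ?f (j + k)) + (\<Sum>j<k. ?f j)"
    unfolding shell_sum_def
    by (rule suminf_split_initial_segment[OF summable_shell_sum]) fact+
  also have "(\<Sum>j<k. ?f j) = 0"
    using zero by (intro sum.neutral) auto
  also have "(\<Sum>j. ?f (j + k)) + 0 \<le> (\<Sum>j. (\<epsilon> / 2 ^ (j + k)) powr \<beta>)"
    unfolding add_0_right
    using summable_shell_sum[of \<epsilon> \<beta> s n] summable_shell_powr[of \<epsilon> \<beta>] assms \<open>0 < \<epsilon>\<close>
    by (intro suminf_le le) (simp_all add: summable_iff_shift[of ?f k] summable_iff_shift[of "\<lambda>k. (\<epsilon> / 2 ^ k) powr \<beta>" k])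
  also have "\<dots> = (\<Sum>j. (\<epsilon> / 2 ^ k) powr \<beta> * (1 / 2 powr \<beta>) ^ j)"
    unfolding shell_powr[OF \<open>0 < \<epsilon>\<close>] by (simp add: power_add mult_ac)
  also have "\<dots> = (\<epsilon> / 2 ^ k) powr \<beta> * (1 / (1 - 1 / 2 powr \<beta>))"
    using one by (subst suminf_mult) (auto simp: suminf_geometric summable_geometric)
  also have "\<dots> \<le> (2 * s) powr \<beta> * (1 / (1 - 1 / 2 powr \<beta>))"
    using k one \<open>0 < \<beta>\<close> \<open>0 < \<epsilon>\<close>
    by (intro mult_right_mono powr_mono2) (auto simp: shell_def field_simps)
  also have "\<dots> = 2 powr \<beta> / (1 - 1 / 2 powr \<beta>) * s powr \<beta>"
    using \<open>0 < s\<close> by (simp add: powr_mult)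
  finally show ?thesis .
qed

text \<open>No closed form of this limit inferior is needed: it is finite and positive, so the weights of
  the mixture can be rescaled to turn it into any prescribed tail coefficient.\<close>

definition shell_tc :: "real \<Rightarrow> real \<Rightarrow> nat \<Rightarrow> real" where
  "shell_tc \<epsilon> \<beta> n = real_of_ereal (Liminf (at_right 0) (\<lambda>s. ereal (shell_sum \<epsilon> \<beta> n s / s powr \<beta>)))"

text \<open>The two preceding bounds keep the ratio between positive constants. The lower one does
  not involve \<open>\<epsilon>\<close>, which later allows the weights to be estimated before
  \<open>\<epsilon>\<close> is fixed.\<close>

lemma
  assumes "0 < \<epsilon>" "0 < \<beta>" "0 < n"
  shows Liminf_shell_sum:
      "Liminf (at_right 0) (\<lambda>s. ereal (shell_sum \<epsilon> \<beta> n s / s powr \<beta>)) = ereal (shell_tc \<epsilon> \<beta> n)"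
    and shell_tc_lower: "1 / 2 powr \<beta> \<le> shell_tc \<epsilon> \<beta> n"
proof -
  let ?L = "Liminf (at_right 0) (\<lambda>s. ereal (shell_sum \<epsilon> \<beta> n s / s powr \<beta>))"
  have ev: "\<forall>\<^sub>F s in at_right 0. 0 < s \<and> s \<le> \<epsilon>"
    using eventually_at_right_real[OF \<open>0 < \<epsilon>\<close>] by (auto elim: eventually_mono)
  have lower: "ereal (1 / 2 powr \<beta>) \<le> ?L"
  proof (rule Liminf_bounded)
    show "\<forall>\<^sub>F s in at_right 0. ereal (1 / 2 powr \<beta>) \<le> ereal (shell_sum \<epsilon> \<beta> n s / s powr \<beta>)"
      using ev
    proof eventually_elim
      case (elim s)
      with shell_sum_lower[of s \<epsilon> \<beta> n] assms show ?case
        by (simp add: powr_divide field_simps)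
    qed
  qed
  moreover have upper: "?L \<le> ereal (2 powr \<beta> / (1 - 1 / 2 powr \<beta>))"
  proof (rule Liminf_le)
    show "\<forall>\<^sub>F s in at_right 0. ereal (shell_sum \<epsilon> \<beta> n s / s powr \<beta>) \<le> ereal (2 powr \<beta> / (1 - 1 / 2 powr \<beta>))"
      using ev
    proof eventually_elim
      case (elim s)
      with shell_sum_upper[of s \<epsilon> \<beta> n] assms show ?case
        by (simp add: pos_divide_le_eq)
    qed
  qed simp
  ultimately show "?L = ereal (shell_tc \<epsilon> \<beta> n)"
    unfolding shell_tc_def by (cases ?L) auto
  with lower show "1 / 2 powr \<beta> \<le> shell_tc \<epsilon> \<beta> n"
    by simp
qed

text \<open>Used with \<open>\<beta> = b M\<close> and \<open>\<gamma> = b N\<close> for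
  \<open>N \<subset> M\<close>: the mass attached to a larger set is negligible at the scale of the
  smaller one.\<close>

lemma shell_sum_smallo:
  assumes "0 < \<epsilon>" "0 < \<beta>" "0 < n" "\<gamma> < \<beta>"
  shows "((\<lambda>s. shell_sum \<epsilon> \<beta> n s / s powr \<gamma>) \<longlongrightarrow> 0) (at_right 0)"
proof (rule tendsto_sandwich)
  let ?D = "2 powr \<beta> / (1 - 1 / 2 powr \<beta>)"
  have ev: "\<forall>\<^sub>F s in at_right 0. 0 < s \<and> s \<le> \<epsilon>"
    using eventually_at_right_real[OF \<open>0 < \<epsilon>\<close>] by (auto elim: eventually_mono)
  show "\<forall>\<^sub>F s in at_right 0. 0 \<le> shell_sum \<epsilon> \<beta> n s / s powr \<gamma>"
    using ev
  proof eventually_elim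
    case (elim s)
    then show ?case
      using shell_sum_lower[of s \<epsilon> \<beta> n] assms by (smt (verit) divide_nonneg_nonneg powr_ge_zero)
  qed
  show "\<forall>\<^sub>F s in at_right 0. shell_sum \<epsilon> \<beta> n s / s powr \<gamma> \<le> ?D * s powr (\<beta> - \<gamma>)"
    using ev
  proof eventually_elim
    case (elim s)
    then show ?case
      using divide_right_mono[OF shell_sum_upper[of s \<epsilon> \<beta> n], of "s powr \<gamma>"] assms
      by (simp add: powr_diff)
  qed
  show "((\<lambda>s. ?D * s powr (\<beta> - \<gamma>)) \<longlongrightarrow> 0) (at_right 0)"
    using \<open>\<gamma> < \<beta>\<close> by real_asymp
qed simp

section \<open>Front faces, corners and one-dimensional marginals\<close>

lemma front_face_mono: "front_face N \<subseteq> front_face M \<longleftrightarrow> N \<subseteq> M"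
proof
  assume "front_face N \<subseteq> front_face M"
  then have "face_support (front_face N) \<subseteq> face_support (front_face M)"
    by (auto simp: face_support_def)
  then show "N \<subseteq> M"
    by (simp add: face_support_front_face)
qed (auto simp: front_face_def)

lemma scaled_front_face:
  assumes "0 < s" "s \<le> 1"
  shows "(\<lambda>u. s *\<^sub>R u) ` front_face N = {u \<in> front_face N. \<forall>i. u $ i \<le> s}"
proof (intro equalityI subsetI)
  fix v assume "v \<in> {u \<in> front_face N. \<forall>i. u $ i \<le> s}"
  then have "(1 / s) *\<^sub>R v \<in> front_face N" "v = s *\<^sub>R ((1 / s) *\<^sub>R v)"
    using assms by (auto simp: front_face_def mem_box_cart)
  then show "v \<in> (\<lambda>u. s *\<^sub>R u) ` front_face N"
    by blast
qed (use assms in \<open>auto simp: front_face_def mem_box_cart mult_le_one mult_left_le\<close>)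

text \<open>On the face the coordinates outside \<open>N\<close> are 0, so only those in
  \<open>N\<close> are constrained, and the corner pulls back to a product set in the cube.\<close>

lemma corner_mass_face_marginal:
  fixes c :: "(real ^ 'r) measure"
  assumes c: "borel_prob_measure_on unit_cube c" and s: "0 < s" "s \<le> 1"
  shows "corner_mass (face_marginal (front_face N) c) s = measure c {u \<in> unit_cube. \<forall>i\<in>N. u $ i \<le> s}"
proof -
  let ?C = "{u \<in> front_face N. \<forall>i. u $ i \<le> s} :: (real ^ 'r) set"
  have "{u :: real ^ 'r. \<forall>i. u $ i \<le> s} \<in> sets borel"
    by measurable
  then have C: "?C \<in> sets (restrict_space borel (front_face N))"
    by (auto simp: sets_restrict_space)
  have "face_proj (front_face N) -` ?C \<inter> space c = {u \<in> unit_cube. \<forall>i\<in>N. u $ i \<le> s}"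
    using c s
    by (auto simp: borel_prob_measure_on_def face_proj_def face_support_front_face
             intro: face_proj_front_face[unfolded face_proj_def face_support_front_face])
  moreover have "space (face_marginal (front_face N) c) = front_face N"
    by (simp add: face_marginal_def space_restrict_space)
  ultimately show ?thesis
    using measure_distr[OF measurable_face_proj[OF c] C]
    by (simp only: corner_mass_def face_marginal_def scaled_front_face[OF s])
qed

text \<open>The projection to the \<open>i\<close>-th axis is \<open>axis i (u $ i)\<close>, so
  preimages of measurable sets are conditions on the \<open>i\<close>-th coordinate alone.\<close>

lemma copula_measureI:
  fixes c :: "(real ^ 'r) measure"
  assumes c: "borel_prob_measure_on unit_cube c"
    and unif: "\<And>i S. S \<in> sets borel \<Longrightarrow> emeasure c {u \<in> unit_cube. u $ i \<in> S} = emeasure lborel (S \<inter> {0..1})"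
  shows "copula_measure c"
  unfolding copula_measure_def
proof (intro conjI allI c)
  fix i :: 'r
  let ?R = "restrict_space borel (front_face {i}) :: (real ^ 'r) measure"
  show "face_marginal (front_face {i}) c = distr (restrict_space lborel {0..1}) ?R (axis i)"
    unfolding face_marginal_def
  proof (rule measure_eqI)
    fix A assume "A \<in> sets (distr c ?R (face_proj (front_face {i})))"
    then have A: "A \<in> sets ?R"
      by simp
    let ?S = "axis i -` A \<inter> {0..1::real}"
    have S: "?S \<in> sets borel"
      using measurable_sets[OF measurable_axis_front_face A]
      by (auto simp: sets_restrict_space space_restrict_space)
    have proj: "face_proj (front_face {i}) u = axis i (u $ i)" for u :: "real ^ 'r"
      by (auto simp: face_proj_def face_support_front_face axis_def vec_eq_iff)
    have "emeasure (distr c ?R (face_proj (front_face {i}))) A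
        = emeasure c (face_proj (front_face {i}) -` A \<inter> space c)"
      by (intro emeasure_distr measurable_face_proj[OF c] A)
    also have "face_proj (front_face {i}) -` A \<inter> space c = {u \<in> unit_cube. u $ i \<in> ?S}"
      using c by (auto simp: proj borel_prob_measure_on_def mem_box_cart)
    also have "emeasure c \<dots> = emeasure lborel (?S \<inter> {0..1})"
      by (rule unif[OF S])
    also have "\<dots> = emeasure (restrict_space lborel {0..1}) (axis i -` A \<inter> space (restrict_space lborel {0..1}))"
      by (subst emeasure_restrict_space) (auto simp: space_restrict_space intro!: arg_cong[where f="emeasure lborel"])
    also have "\<dots> = emeasure (distr (restrict_space lborel {0..1}) ?R (axis i)) A"
      by (intro emeasure_distr[symmetric] measurable_axis_front_face A)
    finally show "emeasure (distr c ?R (face_proj (front_face {i}))) A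
        = emeasure (distr (restrict_space lborel {0..1}) ?R (axis i)) A" .
  qed simp
qed

section \<open>Mixtures of uniform measures on products of shells\<close>

text \<open>\<open>p M k\<close> is the weight of the uniform probability measure on the product that has the \<open>k\<close>-th shell
  as factor in the coordinates in \<open>M\<close> and \<open>{\<epsilon><..1}\<close> in the others. The last two assumptions make
  every marginal uniform.\<close>

locale shell_mixture =
  fixes m :: nat and p :: "'r::finite set \<Rightarrow> nat \<Rightarrow> real"
  assumes m: "2 \<le> m"
    and p_nonneg: "0 \<le> p M k"
    and summable_p: "summable (p M)"
    and sum_p: "(\<Sum>M | i \<in> M. p M k) = 1 / real m / 2 ^ Suc k"
    and total_p: "(\<Sum>M\<in>UNIV. \<Sum>k. p M k) = 1"
begin

text \<open>The reciprocal of an integer, so that 1 and all shell endpoints down to a given level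
  lie on one uniform grid.\<close>

definition \<epsilon> :: real where "\<epsilon> = 1 / real m"

lemma \<epsilon>: "0 < \<epsilon>" "\<epsilon> < 1"
  using m by (auto simp: \<epsilon>_def)

definition slab :: "'r set \<Rightarrow> nat \<Rightarrow> 'r \<Rightarrow> real set" where
  "slab M k i = (if i \<in> M then shell \<epsilon> k else {\<epsilon><..1})"

definition cell :: "'r set \<Rightarrow> nat \<Rightarrow> (real ^ 'r) set" where
  "cell M k = {u. \<forall>i. u $ i \<in> slab M k i}"

text \<open>With values in \<open>ennreal\<close> the infinite sum converges automatically and can
  be exchanged with the integral.\<close>

definition dens :: "real ^ 'r \<Rightarrow> ennreal" where
  "dens u = (\<Sum>M\<in>UNIV. \<Sum>k. ennreal (p M k / (\<Prod>i\<in>UNIV. measure lborel (slab M k i))) * indicator (cell M k) u)"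

definition cop :: "(real ^ 'r) measure" where
  "cop = restrict_space (density lborel dens) unit_cube"

lemma sets_slab [measurable]: "slab M k i \<in> sets borel"
  by (simp add: slab_def)

lemma sets_cell [measurable]: "cell M k \<in> sets borel"
  unfolding cell_def by measurable

lemma measurable_dens [measurable]: "dens \<in> borel_measurable borel"
  unfolding dens_def by measurable

lemma slab_subset: "slab M k i \<subseteq> {0..1}"
proof -
  have "shell \<epsilon> k \<subseteq> {0<..\<epsilon>}"
    using UN_shell[OF \<epsilon>(1)] by blast
  moreover have "{0<..\<epsilon>} \<subseteq> {0..1}" "{\<epsilon><..1} \<subseteq> {0..1}"
    using \<epsilon> by auto
  ultimately show ?thesis
    by (cases "i \<in> M") (simp_all only: slab_def if_True if_False order_trans[of "shell \<epsilon> k"])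
qed

lemma emeasure_Int_slab: "emeasure lborel (X \<inter> slab M k i) = ennreal (measure lborel (X \<inter> slab M k i))"
proof (rule emeasure_eq_ennreal_measure)
  have "emeasure lborel (X \<inter> slab M k i) < \<infinity>"
    using slab_subset[of M k i]
    by (intro emeasure_bounded_finite bounded_subset[OF bounded_closed_interval[of 0 1]]) auto
  then show "emeasure lborel (X \<inter> slab M k i) \<noteq> top"
    by simp
qed

lemma measure_slab_nonzero [simp]: "measure lborel (slab M k i) \<noteq> 0"
  using \<epsilon> by (simp add: slab_def measure_shell)

lemma space_cop: "space cop = unit_cube"
  by (simp add: cop_def space_restrict_space)

lemma sets_cop: "sets cop = sets (restrict_space borel unit_cube)"
  unfolding cop_def by (intro sets_restrict_space_cong) simp

lemma in_sets_cop: "A \<in> sets cop \<longleftrightarrow> A \<in> sets borel \<and> A \<subseteq> unit_cube"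
  unfolding sets_cop by (subst sets_restrict_space_iff) auto

lemma emeasure_cop:
  assumes "A \<in> sets cop"
  shows "emeasure cop A = (\<integral>\<^sup>+u. dens u * indicator A u \<partial>lborel)"
proof -
  have A: "A \<in> sets borel" "A \<subseteq> unit_cube"
    using assms by (simp_all add: in_sets_cop)
  then have "emeasure cop A = emeasure (density lborel dens) A"
    unfolding cop_def by (intro emeasure_restrict_space) auto
  also have "\<dots> = (\<integral>\<^sup>+u. dens u * indicator A u \<partial>lborel)"
    using A by (intro emeasure_density) auto
  finally show ?thesis .
qed

text \<open>The cells are product sets inside the cube, so each uniform law factors over the
  coordinates. The total mass, the marginals and the corner masses are all instances of this
  formula.\<close>

lemma emeasure_cop_product:
  fixes X :: "'r \<Rightarrow> real set"
  assumes [measurable]: "\<And>i. X i \<in> sets borel"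
  shows "emeasure cop {u \<in> unit_cube. \<forall>i. u $ i \<in> X i} =
    (\<Sum>M\<in>UNIV. \<Sum>k. ennreal (p M k * (\<Prod>i\<in>UNIV. measure lborel (X i \<inter> slab M k i) / measure lborel (slab M k i))))"
proof -
  let ?A = "{u :: real ^ 'r. u \<in> unit_cube \<and> (\<forall>i. u $ i \<in> X i)}"
  let ?d = "\<lambda>M k. ennreal (p M k / (\<Prod>i\<in>UNIV. measure lborel (slab M k i)))"
  have [measurable]: "?A \<in> sets borel"
    by measurable
  have cell: "cell M k \<inter> ?A = {u. \<forall>i. u $ i \<in> X i \<inter> slab M k i}" for M k
  proof -
    have "cell M k \<subseteq> unit_cube"
      using slab_subset[of M k] by (fastforce simp: cell_def mem_box_cart)
    then show ?thesis
      by (auto simp: cell_def)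
  qed
  have vol: "emeasure lborel (cell M k \<inter> ?A) = (\<Prod>i\<in>UNIV. ennreal (measure lborel (X i \<inter> slab M k i)))" for M k
    unfolding cell by (subst emeasure_lborel_product_cart) (auto simp: emeasure_Int_slab)
  have eq: "?d M k * (\<Prod>i\<in>UNIV. ennreal (measure lborel (X i \<inter> slab M k i)))
      = ennreal (p M k * (\<Prod>i\<in>UNIV. measure lborel (X i \<inter> slab M k i) / measure lborel (slab M k i)))" for M k
  proof -
    have "?d M k * (\<Prod>i\<in>UNIV. ennreal (measure lborel (X i \<inter> slab M k i)))
        = ?d M k * ennreal (\<Prod>i\<in>UNIV. measure lborel (X i \<inter> slab M k i))"
      by (subst prod_ennreal) simp_all
    also have "\<dots> = ennreal (p M k / (\<Prod>i\<in>UNIV. measure lborel (slab M k i)) * (\<Prod>i\<in>UNIV. measure lborel (X i \<inter> slab M k i)))"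
      by (rule ennreal_mult[symmetric]) (intro divide_nonneg_nonneg prod_nonneg p_nonneg measure_nonneg ballI)+
    finally show ?thesis
      by (simp add: prod_dividef)
  qed
  have "emeasure cop ?A = (\<integral>\<^sup>+u. dens u * indicator ?A u \<partial>lborel)"
    by (intro emeasure_cop) (auto simp: in_sets_cop)
  also have "\<dots> = (\<integral>\<^sup>+u. (\<Sum>M\<in>UNIV. \<Sum>k. ?d M k * indicator (cell M k \<inter> ?A) u) \<partial>lborel)"
    unfolding dens_def
    by (intro nn_integral_cong) (simp add: sum_distrib_right indicator_inter_arith mult.assoc flip: ennreal_suminf_multc)
  also have "\<dots> = (\<Sum>M\<in>UNIV. \<Sum>k. \<integral>\<^sup>+u. ?d M k * indicator (cell M k \<inter> ?A) u \<partial>lborel)"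
    by (simp add: nn_integral_sum nn_integral_suminf)
  also have "\<dots> = (\<Sum>M\<in>UNIV. \<Sum>k. ?d M k * (\<Prod>i\<in>UNIV. ennreal (measure lborel (X i \<inter> slab M k i))))"
    by (simp add: nn_integral_cmult_indicator) (simp only: vol)
  also have "\<dots> = (\<Sum>M\<in>UNIV. \<Sum>k. ennreal (p M k * (\<Prod>i\<in>UNIV. measure lborel (X i \<inter> slab M k i) / measure lborel (slab M k i))))"
    by (simp only: eq)
  finally show ?thesis .
qed

lemma borel_prob_measure_on_cop: "borel_prob_measure_on unit_cube cop"
proof -
  have "emeasure cop {u \<in> unit_cube. \<forall>i. u $ i \<in> UNIV} = (\<Sum>M\<in>UNIV. \<Sum>k. ennreal (p M k))"
    by (subst emeasure_cop_product) (auto intro!: sum.cong suminf_cong)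
  also have "\<dots> = 1"
    using total_p by (simp add: suminf_ennreal2 p_nonneg summable_p suminf_nonneg)
  finally have "prob_space cop"
    by (intro prob_spaceI) (simp add: space_cop)
  then show ?thesis
    by (simp add: borel_prob_measure_on_def space_cop sets_cop)
qed

lemma sum_suminf_p: "(\<Sum>M | i \<in> M. \<Sum>k. p M k) = \<epsilon>"
proof -
  have "(\<Sum>M | i \<in> M. \<Sum>k. p M k) = (\<Sum>k. \<Sum>M | i \<in> M. p M k)"
    by (intro suminf_sum[symmetric] summable_p)
  also have "\<dots> = (\<Sum>k. \<epsilon> / 2 * (1/2) ^ k)"
    by (simp add: sum_p \<epsilon>_def power_divide mult.assoc)
  also have "\<dots> = \<epsilon>"
    by (subst suminf_mult) (auto simp: suminf_geometric summable_geometric)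
  finally show ?thesis .
qed

text \<open>The sets containing \<open>i\<close> give each shell exactly its length, by
  \<open>sum_p\<close>, and hence \<open>\<epsilon>\<close> altogether. The other sets spread the
  remaining mass \<open>1 - \<epsilon>\<close> uniformly over \<open>{\<epsilon><..1}\<close>, which
  has just that length.\<close>

lemma emeasure_cop_coordinate:
  assumes [measurable]: "S \<in> sets borel"
  shows "emeasure cop {u \<in> unit_cube. u $ i \<in> S} = emeasure lborel (S \<inter> {0..1})"
proof -
  let ?X = "\<lambda>j. if j = i then S else UNIV"
  let ?J = "{\<epsilon><..1}"
  have prod: "(\<Prod>j\<in>UNIV. measure lborel (?X j \<inter> slab M k j) / measure lborel (slab M k j))
      = measure lborel (S \<inter> slab M k i) / measure lborel (slab M k i)" (is "?l = ?r") for M k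
  proof -
    have "?l = (\<Prod>j\<in>UNIV. if j = i then ?r else 1)"
      by (intro prod.cong) simp_all
    then show ?thesis
      by simp
  qed
  have shell: "(\<Sum>M | i \<in> M. \<Sum>k. ennreal (p M k * (measure lborel (S \<inter> slab M k i) / measure lborel (slab M k i))))
      = emeasure lborel (S \<inter> {0<..\<epsilon>})"
  proof -
    have "(\<Sum>M | i \<in> M. \<Sum>k. ennreal (p M k * (measure lborel (S \<inter> slab M k i) / measure lborel (slab M k i))))
      = (\<Sum>k. \<Sum>M | i \<in> M. ennreal (p M k * (measure lborel (S \<inter> shell \<epsilon> k) / measure lborel (shell \<epsilon> k))))"
      by (subst suminf_sum) (auto simp: slab_def)
    also have "\<dots> = (\<Sum>k. ennreal (measure lborel (S \<inter> shell \<epsilon> k)))"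
    proof (intro suminf_cong)
      fix k
      have "(\<Sum>M | i \<in> M. ennreal (p M k * (measure lborel (S \<inter> shell \<epsilon> k) / measure lborel (shell \<epsilon> k))))
        = ennreal ((\<Sum>M | i \<in> M. p M k) * (measure lborel (S \<inter> shell \<epsilon> k) / measure lborel (shell \<epsilon> k)))"
        by (simp add: sum_ennreal p_nonneg sum_distrib_right sum_divide_distrib)
      then show "(\<Sum>M | i \<in> M. ennreal (p M k * (measure lborel (S \<inter> shell \<epsilon> k) / measure lborel (shell \<epsilon> k))))
        = ennreal (measure lborel (S \<inter> shell \<epsilon> k))"
        using \<epsilon> by (simp add: sum_p measure_shell[OF \<epsilon>(1)] flip: \<epsilon>_def)
    qed
    also have "\<dots> = (\<Sum>k. emeasure lborel (S \<inter> shell \<epsilon> k))"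
      using emeasure_Int_slab[of S "{i}" _ i] by (simp add: slab_def)
    also have "\<dots> = emeasure lborel (\<Union>k. S \<inter> shell \<epsilon> k)"
      using disjoint_family_shell[OF \<epsilon>(1)]
      by (intro suminf_emeasure) (auto simp: disjoint_family_on_def)
    also have "(\<Union>k. S \<inter> shell \<epsilon> k) = S \<inter> {0<..\<epsilon>}"
      using UN_shell[OF \<epsilon>(1)] by blast
    finally show ?thesis .
  qed
  have top: "(\<Sum>M | i \<notin> M. \<Sum>k. ennreal (p M k * (measure lborel (S \<inter> slab M k i) / measure lborel (slab M k i))))
      = emeasure lborel (S \<inter> ?J)"
  proof -
    have J: "emeasure lborel (S \<inter> ?J) = ennreal (measure lborel (S \<inter> ?J))"
      using emeasure_Int_slab[of S "{}" 0 i] by (simp add: slab_def)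
    define q where "q = measure lborel (S \<inter> ?J) / measure lborel ?J"
    have "0 \<le> q"
      by (simp add: q_def)
    have "(\<Sum>M | i \<notin> M. \<Sum>k. ennreal (p M k * (measure lborel (S \<inter> slab M k i) / measure lborel (slab M k i))))
      = (\<Sum>M | i \<notin> M. \<Sum>k. ennreal (p M k * q))"
      by (intro sum.cong) (auto simp: slab_def q_def)
    also have "\<dots> = (\<Sum>M | i \<notin> M. ennreal ((\<Sum>k. p M k) * q))"
      using \<open>0 \<le> q\<close>
      by (intro sum.cong refl) (simp add: suminf_ennreal2 p_nonneg summable_mult2 summable_p suminf_mult2[symmetric])
    also have "\<dots> = ennreal ((\<Sum>M | i \<notin> M. \<Sum>k. p M k) * q)"
      using \<open>0 \<le> q\<close>
      by (simp add: sum_ennreal suminf_nonneg p_nonneg summable_p sum_distrib_right)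
    also have "(\<Sum>M | i \<notin> M. \<Sum>k. p M k) = 1 - \<epsilon>"
    proof -
      have "(\<Sum>M\<in>UNIV. \<Sum>k. p M k) = (\<Sum>M | i \<in> M. \<Sum>k. p M k) + (\<Sum>M | i \<notin> M. \<Sum>k. p M k)"
        by (subst sum.union_disjoint[symmetric]) (auto intro!: sum.cong)
      then show ?thesis
        by (simp add: total_p sum_suminf_p)
    qed
    also have "(1 - \<epsilon>) * q = measure lborel (S \<inter> ?J)"
      using \<epsilon> by (simp add: q_def)
    finally show ?thesis
      by (simp only: J)
  qed
  have "{u :: real ^ 'r. u \<in> unit_cube \<and> u $ i \<in> S} = {u \<in> unit_cube. \<forall>j. u $ j \<in> ?X j}"
    by auto
  also have "emeasure cop \<dots>
     = (\<Sum>M\<in>UNIV. \<Sum>k. ennreal (p M k * (measure lborel (S \<inter> slab M k i) / measure lborel (slab M k i))))"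
    unfolding prod[symmetric] by (intro emeasure_cop_product) simp
  also have "\<dots> = emeasure lborel (S \<inter> {0<..\<epsilon>}) + emeasure lborel (S \<inter> ?J)"
    unfolding shell[symmetric] top[symmetric]
    by (subst sum.union_disjoint[symmetric]) (auto intro!: sum.cong)
  also have "\<dots> = emeasure lborel (S \<inter> {0<..\<epsilon>} \<union> S \<inter> ?J)"
    by (rule plus_emeasure) auto
  also have "S \<inter> {0<..\<epsilon>} \<union> S \<inter> ?J = S \<inter> {0<..1}"
    using \<epsilon> by auto
  \<comment> \<open>The shells never reach 0, but a single point has length 0.\<close>
  also have "emeasure lborel (S \<inter> {0<..1}) = emeasure lborel (S \<inter> {0..1})"
  proof (rule emeasure_eq_AE)
    show "AE x in lborel. x \<in> S \<inter> {0<..1} \<longleftrightarrow> x \<in> S \<inter> {0..1}"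
      using AE_lborel_singleton[of "0::real"] by eventually_elim auto
  qed auto
  finally show ?thesis .
qed

lemma copula_measure_cop: "copula_measure cop"
  by (intro copula_measureI borel_prob_measure_on_cop emeasure_cop_coordinate)

text \<open>If some coordinate of \<open>N\<close> is missing from \<open>M\<close>, the cell
  exceeds \<open>\<epsilon> \<ge> s\<close> there and misses the corner. Otherwise every coordinate
  in \<open>N\<close> contributes the factor \<open>shell_part \<epsilon> k s\<close>, and the
  others contribute 1.\<close>

lemma measure_cop_corner:
  assumes "0 < s" "s \<le> \<epsilon>"
  shows "measure cop {u \<in> unit_cube. \<forall>i\<in>N. u $ i \<le> s} = (\<Sum>M | N \<subseteq> M. \<Sum>k. p M k * shell_part \<epsilon> k s ^ card N)"
proof -
  let ?X = "\<lambda>j. if j \<in> N then {..s} else UNIV"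
  let ?f = "\<lambda>M k. if N \<subseteq> M then p M k * shell_part \<epsilon> k s ^ card N else 0"
  have prod: "p M k * (\<Prod>j\<in>UNIV. measure lborel (?X j \<inter> slab M k j) / measure lborel (slab M k j)) = ?f M k"
    (is "_ * ?l = _") for M k
  proof -
    have "?l = (\<Prod>j\<in>UNIV. if j \<in> N then measure lborel ({..s} \<inter> slab M k j) / measure lborel (slab M k j) else 1)"
      by (intro prod.cong) simp_all
    also have "\<dots> = (\<Prod>j\<in>N. measure lborel ({..s} \<inter> slab M k j) / measure lborel (slab M k j))"
      by (simp add: prod.If_cases)
    also have "\<dots> = (if N \<subseteq> M then shell_part \<epsilon> k s ^ card N else 0)"
    proof (cases "N \<subseteq> M")
      case True
      then have "(\<Prod>j\<in>N. measure lborel ({..s} \<inter> slab M k j) / measure lborel (slab M k j))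
          = (\<Prod>j\<in>N. shell_part \<epsilon> k s)"
        by (intro prod.cong) (auto simp: slab_def shell_part_def)
      then show ?thesis
        using True by simp
    next
      case False
      then obtain j where "j \<in> N" "j \<notin> M"
        by blast
      moreover have "{..s} \<inter> {\<epsilon><..1} = {}"
        using assms by auto
      ultimately show ?thesis
        using False by (auto simp: slab_def intro!: prod_zero bexI[of _ j])
    qed
    finally show ?thesis
      by simp
  qed
  have nonneg: "0 \<le> ?f M k" for M k
    by (simp add: p_nonneg shell_part_nonneg)
  have summable: "summable (?f M)" for M
  proof (rule summable_comparison_test'[OF summable_p])
    show "norm (?f M k) \<le> p M k" for k
      using power_le_one[OF shell_part_nonneg shell_part_le_1, of \<epsilon> k s "card N"] p_nonneg[of M k]
      by (simp add: shell_part_nonneg mult_left_le)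
  qed
  have "{u :: real ^ 'r. u \<in> unit_cube \<and> (\<forall>i\<in>N. u $ i \<le> s)} = {u. u \<in> unit_cube \<and> (\<forall>j. u $ j \<in> ?X j)}"
    by auto
  then have "emeasure cop {u \<in> unit_cube. \<forall>i\<in>N. u $ i \<le> s} = (\<Sum>M\<in>UNIV. \<Sum>k. ennreal (?f M k))"
    by (simp add: emeasure_cop_product) (simp only: prod)
  also have "\<dots> = ennreal (\<Sum>M\<in>UNIV. \<Sum>k. ?f M k)"
    using nonneg summable by (simp add: suminf_ennreal2 suminf_nonneg)
  finally have "measure cop {u \<in> unit_cube. \<forall>i\<in>N. u $ i \<le> s} = (\<Sum>M\<in>UNIV. \<Sum>k. ?f M k)"
    using nonneg summable by (simp add: measure_def sum_nonneg suminf_nonneg)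
  also have "\<dots> = (\<Sum>M\<in>UNIV. if N \<subseteq> M then \<Sum>k. p M k * shell_part \<epsilon> k s ^ card N else 0)"
    by (intro sum.cong) auto
  also have "\<dots> = (\<Sum>M | N \<subseteq> M. \<Sum>k. p M k * shell_part \<epsilon> k s ^ card N)"
    by (simp add: sum.If_cases)
  finally show ?thesis .
qed

end

section \<open>Local uniformity\<close>

definition grid_box :: "nat \<Rightarrow> ('r \<Rightarrow> nat) \<Rightarrow> (real ^ 'r) set" where
  "grid_box n e = cbox (\<chi> i. real (e i) / real n) (\<chi> i. real (Suc (e i)) / real n)"

lemma interior_grid_box:
  "interior (grid_box n e) = {u. \<forall>i. real (e i) / real n < u $ i \<and> u $ i < real (Suc (e i)) / real n}"
  unfolding grid_box_def interior_cbox by (auto simp: mem_box_cart)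

text \<open>No grid point lies inside a grid interval, so comparison with a grid point depends on
  the index only. This serves both the disjointness of the box interiors and the constancy of the
  density on them.\<close>

lemma grid_threshold:
  assumes "0 < n" "real j / real n < x" "x < real (Suc j) / real n"
  shows "x \<le> real q / real n \<longleftrightarrow> j < q"
proof
  assume "x \<le> real q / real n"
  with assms have "real j / real n < real q / real n"
    by linarith
  then show "j < q"
    using \<open>0 < n\<close> by (simp add: divide_less_cancel)
next
  assume "j < q"
  then have "real (Suc j) / real n \<le> real q / real n"
    by (intro divide_right_mono) auto
  with assms show "x \<le> real q / real n"
    by linarith
qed

lemma grid_interval_exists:
  assumes "0 < n" "0 \<le> x" "x \<le> (1::real)"
  shows "\<exists>j<n. real j / real n \<le> x \<and> x \<le> real (Suc j) / real n"
proof (cases "x = 1")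
  case True
  \<comment> \<open>The right endpoint belongs to the last interval; rounding down would give the
    index \<open>n\<close>, which is out of range.\<close>
  then show ?thesis
    using \<open>0 < n\<close> by (intro exI[of _ "n - 1"]) auto
next
  case False
  define j where "j = nat \<lfloor>x * n\<rfloor>"
  have j: "real j \<le> x * n" "x * n < real j + 1"
    using assms by (simp_all add: j_def)
  moreover have "x * real n < 1 * real n"
    using assms False by (intro mult_strict_right_mono) auto
  ultimately have "j < n"
    by linarith
  with j \<open>0 < n\<close> show ?thesis
    by (intro exI[of _ j]) (simp add: field_simps)
qed

lemma grid_division:
  assumes "0 < n"
  shows "grid_box n ` (UNIV \<rightarrow>\<^sub>E {..<n}) division_of (unit_cube :: (real ^ 'r::finite) set)"
proof -
  have sub: "grid_box n e \<subseteq> unit_cube" if "\<And>i. e i < n" for e :: "'r \<Rightarrow> nat"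
  proof
    have le: "real (Suc (e i)) / real n \<le> 1" for i
      using \<open>0 < n\<close> that by (simp add: Suc_le_eq del: of_nat_Suc)
    fix u assume "u \<in> grid_box n e"
    then have u: "real (e i) / real n \<le> u $ i" "u $ i \<le> real (Suc (e i)) / real n" for i
      by (auto simp: grid_box_def mem_box_cart)
    have "0 \<le> u $ i" for i
      by (rule order_trans[OF _ u(1)]) simp
    moreover have "u $ i \<le> 1" for i
      by (rule order_trans[OF u(2) le])
    ultimately show "u \<in> unit_cube"
      by (simp add: mem_box_cart)
  qed
  show ?thesis
  proof (rule division_ofI)
    show "finite (grid_box n ` (UNIV \<rightarrow>\<^sub>E {..<n}) :: (real ^ 'r) set set)"
      by (intro finite_imageI finite_PiE) auto
    fix K assume "K \<in> grid_box n ` ((UNIV :: 'r set) \<rightarrow>\<^sub>E {..<n})"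
    then obtain e where e: "K = grid_box n e" "\<And>i. e i < n"
      by auto
    then show "K \<subseteq> unit_cube"
      using sub by simp
    show "K \<noteq> {}"
      using \<open>0 < n\<close> by (auto simp: e grid_box_def interval_ne_empty_cart divide_right_mono)
    show "\<exists>a b. K = cbox a b"
      by (auto simp: e grid_box_def)
    fix K' assume "K' \<in> grid_box n ` ((UNIV :: 'r set) \<rightarrow>\<^sub>E {..<n})" "K \<noteq> K'"
    then obtain e' where e': "K' = grid_box n e'" "e \<noteq> e'"
      using e by auto
    show "interior K \<inter> interior K' = {}"
    proof (rule ccontr)
      assume "interior K \<inter> interior K' \<noteq> {}"
      then obtain u where u: "u \<in> interior (grid_box n e)" "u \<in> interior (grid_box n e')"
        using e e' by auto
      \<comment> \<open>A common interior point determines both index functions, through the grid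
        points above it.\<close>
      have "e i < q \<longleftrightarrow> u $ i \<le> real q / real n" "e' i < q \<longleftrightarrow> u $ i \<le> real q / real n" for i q
        using u by (intro grid_threshold[OF \<open>0 < n\<close>, symmetric]; simp add: interior_grid_box)+
      then have "e i < q \<longleftrightarrow> e' i < q" for i q
        by simp
      then have "e i = e' i" for i
        by (metis nat_neq_iff)
      with e' show False
        by auto
    qed
  next
    show "\<Union> (grid_box n ` (UNIV \<rightarrow>\<^sub>E {..<n})) = (unit_cube :: (real ^ 'r) set)"
    proof
      show "\<Union> (grid_box n ` (UNIV \<rightarrow>\<^sub>E {..<n})) \<subseteq> (unit_cube :: (real ^ 'r) set)"
        using sub by blast
      show "(unit_cube :: (real ^ 'r) set) \<subseteq> \<Union> (grid_box n ` (UNIV \<rightarrow>\<^sub>E {..<n}))"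
      proof
        fix u :: "real ^ 'r" assume "u \<in> unit_cube"
        then have "\<forall>i. \<exists>j<n. real j / real n \<le> u $ i \<and> u $ i \<le> real (Suc j) / real n"
          using grid_interval_exists[OF \<open>0 < n\<close>] by (auto simp: mem_box_cart)
        then obtain e where "\<And>i. e i < n" "\<And>i. real (e i) / real n \<le> u $ i \<and> u $ i \<le> real (Suc (e i)) / real n"
          by metis
        then show "u \<in> \<Union> (grid_box n ` (UNIV \<rightarrow>\<^sub>E {..<n}))"
          by (intro UN_I[of e]) (auto simp: grid_box_def mem_box_cart)
      qed
    qed
  qed
qed

text \<open>The box measure near \<open>w\<close> is \<open>c\<close> truncated to \<open>U\<close>.
  It agrees with \<open>c\<close> on subsets of \<open>U\<close>, so only its constancy on the boxes
  of one grid has to be checked.\<close>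

lemma locally_piecewise_uniform_onI:
  fixes c :: "(real ^ 'r) measure"
  assumes c: "borel_prob_measure_on unit_cube c"
    and loc: "\<And>w. w \<in> E \<Longrightarrow> \<exists>U n. open U \<and> w \<in> U \<and> 0 < n \<and>
      (\<forall>e. \<exists>\<kappa>. \<forall>A\<in>sets c. A \<subseteq> grid_box n e \<longrightarrow> measure c (A \<inter> U) = \<kappa> * measure lborel A)"
    and E: "E \<subseteq> unit_cube"
  shows "locally_piecewise_uniform_on E c"
  unfolding locally_piecewise_uniform_on_def
proof
  fix w assume "w \<in> E"
  interpret prob_space c
    using c by (simp add: borel_prob_measure_on_def)
  have sp: "space c = unit_cube" and st: "sets c = sets (restrict_space borel unit_cube)"
    using c by (simp_all add: borel_prob_measure_on_def)
  have in_sets: "A \<in> sets c \<longleftrightarrow> A \<in> sets borel \<and> A \<subseteq> unit_cube" for A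
    unfolding st by (subst sets_restrict_space_iff) auto
  from loc[OF \<open>w \<in> E\<close>] obtain U n where U: "open U" "w \<in> U" "0 < n"
    and const: "\<And>e. \<exists>\<kappa>. \<forall>A\<in>sets c. A \<subseteq> grid_box n e \<longrightarrow> measure c (A \<inter> U) = \<kappa> * measure lborel A"
    by blast
  have W: "unit_cube \<inter> U \<in> sets c"
    using U by (auto simp: in_sets)
  have "box_measure (\<lambda>A. measure c (A \<inter> U))"
    unfolding box_measure_def
  proof (intro conjI exI)
    show "signed_measure (restrict_space borel unit_cube) (\<lambda>A. measure c (A \<inter> U))"
      unfolding signed_measure_def
    proof (intro conjI allI impI)
      fix A :: "nat \<Rightarrow> (real ^ 'r) set"
      assume A: "range A \<subseteq> sets (restrict_space borel unit_cube)" "disjoint_family A"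
      then have sets_A: "A k \<in> sets c" for k
        using st by auto
      have "A k \<inter> U = A k \<inter> (unit_cube \<inter> U)" for k
        using sets_A[of k] by (auto simp: in_sets)
      then have "A k \<inter> U \<in> sets c" for k
        using sets_A[of k] W by auto
      moreover have "disjoint_family (\<lambda>k. A k \<inter> U)"
        using A(2) unfolding disjoint_family_on_def by blast
      ultimately have "(\<lambda>k. measure c (A k \<inter> U)) sums measure c (\<Union>k. A k \<inter> U)"
        by (intro finite_measure_UNION) auto
      then show "(\<lambda>k. measure c (A k \<inter> U)) sums measure c ((\<Union>k. A k) \<inter> U)"
        by simp
    qed simp
    let ?D = "grid_box n ` ((UNIV :: 'r set) \<rightarrow>\<^sub>E {..<n})"
    show D: "?D division_of unit_cube"
      by (rule grid_division) fact
    show "\<forall>B\<in>?D. \<exists>l u. B = cbox l u \<and> (\<forall>i. l $ i < u $ i)"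
    proof
      fix B assume "B \<in> ?D"
      then obtain e where "B = cbox (\<chi> i. real (e i) / real n) (\<chi> i. real (Suc (e i)) / real n)"
        by (auto simp: grid_box_def)
      then show "\<exists>l u. B = cbox l u \<and> (\<forall>i. l $ i < u $ i)"
        using \<open>0 < n\<close> by (intro exI conjI) (auto simp: divide_strict_right_mono)
    qed
    show "\<forall>B\<in>?D. \<exists>k::real. \<forall>A\<in>sets borel. A \<subseteq> B \<longrightarrow> measure c (A \<inter> U) = k * measure lborel A"
    proof
      fix B assume "B \<in> ?D"
      with D have B: "B \<subseteq> unit_cube"
        by auto
      obtain e where e: "B = grid_box n e"
        using \<open>B \<in> ?D\<close> by blast
      obtain \<kappa> where \<kappa>: "\<forall>A\<in>sets c. A \<subseteq> grid_box n e \<longrightarrow> measure c (A \<inter> U) = \<kappa> * measure lborel A"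
        using const by blast
      have "measure c (A \<inter> U) = \<kappa> * measure lborel A" if "A \<in> sets borel" "A \<subseteq> B" for A
        using \<kappa> that B by (simp add: in_sets e)
      then show "\<exists>k::real. \<forall>A\<in>sets borel. A \<subseteq> B \<longrightarrow> measure c (A \<inter> U) = k * measure lborel A"
        by blast
    qed
  qed
  moreover have "openin (top_of_set unit_cube) (unit_cube \<inter> U)" "w \<in> unit_cube \<inter> U"
    using U E \<open>w \<in> E\<close> by auto
  moreover have "A \<inter> U = A" if "A \<subseteq> unit_cube \<inter> U" for A
    using that by auto
  ultimately show "\<exists>W\<in>sets c. \<exists>\<mu>. (\<exists>U. openin (top_of_set unit_cube) U \<and> w \<in> U \<and> U \<subseteq> W) \<and>
      box_measure \<mu> \<and> (\<forall>A\<in>sets c. A \<subseteq> W \<longrightarrow> measure c A = \<mu> A)"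
    using W by (intro bexI[of _ "unit_cube \<inter> U"] exI[of _ "\<lambda>A. measure c (A \<inter> U)"]) auto
qed

section \<open>The density of the mixture on grid boxes\<close>

context shell_mixture
begin

lemma threshold_grid_cell:
  assumes x: "real q / real (m * 2 ^ k) < x" "x < real (Suc q) / real (m * 2 ^ k)"
    and y: "real q / real (m * 2 ^ k) < y" "y < real (Suc q) / real (m * 2 ^ k)"
    and j: "j \<le> k"
  shows "x \<le> \<epsilon> / 2 ^ j \<longleftrightarrow> y \<le> \<epsilon> / 2 ^ j" "x \<le> 1 \<longleftrightarrow> y \<le> 1"
proof -
  have n: "0 < m * 2 ^ k"
    using m by simp
  have eq: "\<epsilon> / 2 ^ j = real (2 ^ (k - j)) / real (m * 2 ^ k)"
    using j m by (simp add: \<epsilon>_def field_simps flip: power_add)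
  show "x \<le> \<epsilon> / 2 ^ j \<longleftrightarrow> y \<le> \<epsilon> / 2 ^ j"
    unfolding eq grid_threshold[OF n x] grid_threshold[OF n y] ..
  have "1 = real (m * 2 ^ k) / real (m * 2 ^ k)"
    using m by simp
  then show "x \<le> 1 \<longleftrightarrow> y \<le> 1"
    using grid_threshold[OF n x] grid_threshold[OF n y] by metis
qed

text \<open>All shell endpoints that exceed \<open>\<epsilon> / 2 ^ k\<close> are multiples of the mesh width \<open>1 / (m * 2 ^ k)\<close>.\<close>

lemma dens_constant_on_grid_box:
  assumes u: "u \<in> interior (grid_box (m * 2 ^ k) e)" and v: "v \<in> interior (grid_box (m * 2 ^ k) e)"
    and far: "\<And>i. \<epsilon> / 2 ^ k < u $ i" "\<And>i. \<epsilon> / 2 ^ k < v $ i"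
  shows "dens u = dens v"
proof -
  have thr: "u $ i \<le> \<epsilon> / 2 ^ j \<longleftrightarrow> v $ i \<le> \<epsilon> / 2 ^ j" for i j
  proof (cases "j \<le> k")
    case True
    then show ?thesis
      using u v by (intro threshold_grid_cell) (auto simp: interior_grid_box)
  next
    case False
    then have "\<epsilon> / 2 ^ j \<le> \<epsilon> / 2 ^ k"
      using \<epsilon> by (intro divide_left_mono power_increasing) auto
    then show ?thesis
      using far[of i] by linarith
  qed
  have one: "u $ i \<le> 1 \<longleftrightarrow> v $ i \<le> 1" for i
    using u v threshold_grid_cell(2)[of "e i" k "u $ i" "v $ i" 0] by (auto simp: interior_grid_box)
  have "u $ i \<in> slab M j i \<longleftrightarrow> v $ i \<in> slab M j i" for M j i
    using thr[of i j] thr[of i "Suc j"] thr[of i 0] one[of i]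
    by (auto simp: slab_def shell_def not_le[symmetric] simp del: power_Suc)
  then have "u \<in> cell M j \<longleftrightarrow> v \<in> cell M j" for M j
    by (simp add: cell_def)
  then show ?thesis
    by (simp add: dens_def indicator_def)
qed

lemma locally_piecewise_uniform_cop: "locally_piecewise_uniform_on (box 0 1) cop"
proof (rule locally_piecewise_uniform_onI[OF borel_prob_measure_on_cop])
  show "box 0 1 \<subseteq> (unit_cube :: (real ^ 'r) set)"
    by (rule box_subset_cbox)
  fix w :: "real ^ 'r" assume "w \<in> box 0 1"
  then have w: "0 < w $ i" for i
    by (auto simp: mem_box_cart)
  \<comment> \<open>Below level \<open>k\<close> all shells stay out of the neighbourhood of
    \<open>w\<close> on which every coordinate exceeds \<open>\<epsilon> / 2 ^ k\<close>, so
    finitely many endpoints matter there.\<close>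
  have "\<forall>\<^sub>F k in sequentially. \<forall>i\<in>UNIV. \<epsilon> / 2 ^ k < w $ i"
  proof (intro eventually_ball_finite ballI)
    fix i
    have "(\<lambda>k. \<epsilon> / 2 ^ k) \<longlonglongrightarrow> 0"
      by real_asymp
    then show "\<forall>\<^sub>F k in sequentially. \<epsilon> / 2 ^ k < w $ i"
      using w by (intro order_tendstoD) auto
  qed simp
  then obtain k where k: "\<And>i. \<epsilon> / 2 ^ k < w $ i"
    by (auto simp: eventually_sequentially)
  let ?n = "m * 2 ^ k" and ?U = "{u :: real ^ 'r. \<forall>i. \<epsilon> / 2 ^ k < u $ i}"
  have "?U = (\<Inter>i. {u. \<epsilon> / 2 ^ k < u $ i})"
    by auto
  then have "open ?U"
    by (simp only:) (intro open_INT ballI open_halfspace_component_gt_cart finite)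
  moreover have "\<exists>\<kappa>. \<forall>A\<in>sets cop. A \<subseteq> grid_box ?n e \<longrightarrow> measure cop (A \<inter> ?U) = \<kappa> * measure lborel A" for e
  proof -
    let ?I = "interior (grid_box ?n e) :: (real ^ 'r) set"
    \<comment> \<open>As \<open>\<epsilon> / 2 ^ k\<close> is a grid point, the interior of a grid
      box lies either inside \<open>?U\<close> or outside it, so the truncated density is constant
      there.\<close>
    obtain \<kappa> where \<kappa>: "\<And>u. u \<in> ?I \<Longrightarrow> dens u * indicator ?U u = \<kappa>"
    proof (cases "\<exists>v. v \<in> ?I \<inter> ?U")
      case True
      then obtain v where v: "v \<in> ?I" "\<And>i. \<epsilon> / 2 ^ k < v $ i"
        by blast
      have "dens u * indicator ?U u = dens v" if "u \<in> ?I" for u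
      proof -
        have "\<epsilon> / 2 ^ k < u $ i" for i
          using threshold_grid_cell(1)[of "e i" k "u $ i" "v $ i" k] v(1) v(2)[of i] that
          by (auto simp: interior_grid_box not_le[symmetric])
        then show ?thesis
          using dens_constant_on_grid_box[OF that v(1) _ v(2)] by simp
      qed
      then show ?thesis
        using that by blast
    next
      case False
      then show ?thesis
        by (intro that[of 0]) (auto simp: indicator_def)
    qed
    have "negligible (grid_box ?n e - ?I)"
      unfolding grid_box_def interior_cbox by (rule negligible_frontier_interval)
    then have "grid_box ?n e - ?I \<in> null_sets lborel"
      by (subst null_sets_completion_iff[symmetric]) (auto simp: negligible_iff_null_sets grid_box_def)
    then have AE: "AE u in lborel. u \<notin> grid_box ?n e - ?I"
      by (rule AE_not_in)
    have "measure cop (A \<inter> ?U) = enn2real \<kappa> * measure lborel A"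
      if A: "A \<in> sets cop" "A \<subseteq> grid_box ?n e" for A
    proof -
      have [measurable]: "A \<in> sets borel"
        using A by (simp add: in_sets_cop)
      have "A \<inter> ?U \<in> sets cop"
        using A \<open>open ?U\<close> by (auto simp: in_sets_cop)
      then have "emeasure cop (A \<inter> ?U) = (\<integral>\<^sup>+u. dens u * indicator (A \<inter> ?U) u \<partial>lborel)"
        by (rule emeasure_cop)
      also have "\<dots> = (\<integral>\<^sup>+u. \<kappa> * indicator A u \<partial>lborel)"
        using AE
      proof (intro nn_integral_cong_AE, eventually_elim)
        case (elim u)
        show ?case
        proof (cases "u \<in> A")
          case True
          with A elim have "u \<in> ?I"
            by auto
          then show ?thesis
            using \<kappa>[of u] True by (auto simp: indicator_def split: if_splits)
        qed simp
      qed
      also have "\<dots> = \<kappa> * emeasure lborel A"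
        by (simp add: nn_integral_cmult_indicator)
      finally show ?thesis
        by (simp add: measure_def enn2real_mult)
    qed
    then show ?thesis
      by blast
  qed
  moreover have "0 < ?n"
    using m by simp
  ultimately show "\<exists>U n. open U \<and> w \<in> U \<and> 0 < n \<and>
      (\<forall>e. \<exists>\<kappa>. \<forall>A\<in>sets cop. A \<subseteq> grid_box n e \<longrightarrow> measure cop (A \<inter> U) = \<kappa> * measure lborel A)"
    using k by blast
qed

end

section \<open>Prescribing the tail characteristic\<close>

text \<open>The weights of the singletons fill each shell up to its length, and the weight of the empty set
  brings the total up to 1; \<open>CARD('r) \<le> m\<close> keeps the latter nonnegative.\<close>

lemma shell_mixture_completion:
  fixes q :: "'r::finite set \<Rightarrow> nat \<Rightarrow> real"
  assumes m: "2 \<le> m" "CARD('r) \<le> m"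
    and q_nonneg: "\<And>M k. 0 \<le> q M k"
    and summable_q: "\<And>M. 2 \<le> card M \<Longrightarrow> summable (q M)"
    and bound: "\<And>k. (\<Sum>M | 2 \<le> card M. q M k) \<le> 1 / real m / 2 ^ Suc k"
  obtains p where "shell_mixture m p" "\<And>M k. 2 \<le> card M \<Longrightarrow> p M k = q M k"
proof -
  let ?e = "1 / real m"
  \<comment> \<open>For \<open>M = {i}\<close> this is the part of the shell's length that the
    larger sets containing \<open>i\<close> leave over. The value at \<open>{}\<close> is overridden
    in \<open>p\<close>.\<close>
  define p1 where "p1 M k = (if 2 \<le> card M then q M k
    else ?e / 2 ^ Suc k - (\<Sum>M' | M \<subseteq> M' \<and> 2 \<le> card M'. q M' k))" for M k
  define T where "T = (\<Sum>M | M \<noteq> {}. \<Sum>k. p1 M k)"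
  \<comment> \<open>The cell of \<open>{}\<close> is the same for every \<open>k\<close>, so its
    whole weight can sit at \<open>k = 0\<close>.\<close>
  define p where "p M k = (if M = {} then (if k = 0 then 1 - T else 0) else p1 M k)" for M k
  have summable_e: "summable (\<lambda>k. ?e / 2 ^ Suc k)"
  proof -
    have "summable (\<lambda>k. ?e / 2 * (1 / 2) ^ k)"
      by (intro summable_mult summable_geometric) auto
    then show ?thesis
      by (simp add: power_divide mult.assoc)
  qed
  have suminf_e: "(\<Sum>k. ?e / 2 ^ Suc k) = ?e"
  proof -
    have "(\<Sum>k. ?e / 2 * (1 / 2) ^ k) = ?e"
      by (subst suminf_mult) (auto simp: suminf_geometric summable_geometric)
    then show ?thesis
      by (simp add: power_divide mult.assoc)
  qed
  have p1_nonneg: "0 \<le> p1 M k" for M k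
  proof -
    have "(\<Sum>M' | M \<subseteq> M' \<and> 2 \<le> card M'. q M' k) \<le> (\<Sum>M | 2 \<le> card M. q M k)"
      by (intro sum_mono2) (auto simp: q_nonneg)
    with bound[of k] show ?thesis
      by (auto simp: p1_def q_nonneg)
  qed
  have summable_p1: "summable (p1 M)" for M
  proof (cases "2 \<le> card M")
    case True
    then show ?thesis
      using summable_q[OF True] by (simp add: p1_def[abs_def])
  next
    case False
    have "summable (\<lambda>k. ?e / 2 ^ Suc k - (\<Sum>M' | M \<subseteq> M' \<and> 2 \<le> card M'. q M' k))"
      by (intro summable_diff summable_e summable_sum summable_q) auto
    then show ?thesis
      using False by (simp add: p1_def[abs_def])
  qed
  have sum_p1: "(\<Sum>M | i \<in> M. p1 M k) = ?e / 2 ^ Suc k" for i k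
  proof -
    have "{M. i \<in> M} = insert {i} {M. {i} \<subseteq> M \<and> 2 \<le> card M}"
    proof (intro equalityI subsetI)
      fix M :: "'r set" assume "M \<in> {M. i \<in> M}"
      then have "0 < card M" "i \<in> M"
        by (auto simp: card_gt_0_iff)
      then show "M \<in> insert {i} {M. {i} \<subseteq> M \<and> 2 \<le> card M}"
        by (cases "card M = 1") (auto elim!: card_1_singletonE simp del: One_nat_def)
    qed auto
    then have "(\<Sum>M | i \<in> M. p1 M k) = p1 {i} k + (\<Sum>M | {i} \<subseteq> M \<and> 2 \<le> card M. p1 M k)"
      by (simp only:) (subst sum.insert; simp)
    also have "(\<Sum>M | {i} \<subseteq> M \<and> 2 \<le> card M. p1 M k) = (\<Sum>M | {i} \<subseteq> M \<and> 2 \<le> card M. q M k)"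
      by (intro sum.cong) (auto simp: p1_def)
    also have "p1 {i} k + \<dots> = ?e / 2 ^ Suc k"
      by (simp add: p1_def)
    finally show ?thesis .
  qed
  \<comment> \<open>Double counting: the factor \<open>card M\<close> counts each nonempty set at
    least once, and after exchanging the sums every coordinate contributes
    \<open>1 / real m\<close>.\<close>
  have "T \<le> (\<Sum>M\<in>UNIV. real (card M) * (\<Sum>k. p1 M k))"
    unfolding T_def
  proof (rule order_trans[OF sum_mono sum_mono2])
    fix M :: "'r set" assume "M \<in> {M. M \<noteq> {}}"
    then have "1 \<le> card M"
      by (simp add: Suc_le_eq card_gt_0_iff)
    then show "(\<Sum>k. p1 M k) \<le> real (card M) * (\<Sum>k. p1 M k)"
      using suminf_nonneg[OF summable_p1 p1_nonneg, of M] mult_right_mono[of 1 "real (card M)" "\<Sum>k. p1 M k"] by simp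
  qed (auto intro!: mult_nonneg_nonneg suminf_nonneg summable_p1 p1_nonneg)
  also have "\<dots> = (\<Sum>M\<in>UNIV. \<Sum>i | i \<in> UNIV \<and> i \<in> M. \<Sum>k. p1 M k)"
    by simp
  also have "\<dots> = (\<Sum>i\<in>UNIV. \<Sum>M | M \<in> UNIV \<and> i \<in> M. \<Sum>k. p1 M k)"
    by (rule sum.swap_restrict) auto
  also have "\<dots> = (\<Sum>i\<in>(UNIV :: 'r set). ?e)"
  proof (intro sum.cong refl)
    fix i
    have "(\<Sum>M | i \<in> M. \<Sum>k. p1 M k) = (\<Sum>k. \<Sum>M | i \<in> M. p1 M k)"
      by (intro suminf_sum[symmetric] summable_p1)
    then show "(\<Sum>M | M \<in> UNIV \<and> i \<in> M. \<Sum>k. p1 M k) = ?e"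
      by (simp only: UNIV_I simp_thms sum_p1 suminf_e)
  qed
  also have "\<dots> \<le> 1"
    using m by (simp add: divide_le_eq)
  finally have "T \<le> 1" .
  have "shell_mixture m p"
  proof
    show "0 \<le> p M k" for M k
      using \<open>T \<le> 1\<close> by (simp add: p_def p1_nonneg)
    show "summable (p M)" for M
    proof (cases "M = {}")
      case True
      have "summable (\<lambda>k. if k = 0 then 1 - T else 0)"
        by (rule summable_single)
      with True show ?thesis
        by (simp add: p_def[abs_def])
    next
      case False
      then show ?thesis
        using summable_p1[of M] by (simp add: p_def[abs_def])
    qed
    show "(\<Sum>M | i \<in> M. p M k) = ?e / 2 ^ Suc k" for i k
      unfolding sum_p1[of k i, symmetric] by (intro sum.cong) (auto simp: p_def)
    have "(\<Sum>k. p {} k) = 1 - T"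
      using sums_unique[OF sums_single[of 0 "\<lambda>_. 1 - T"]] by (simp add: p_def)
    moreover have "(\<Sum>M | M \<noteq> {}. \<Sum>k. p M k) = T"
      unfolding T_def by (intro sum.cong suminf_cong) (auto simp: p_def)
    moreover have "(\<Sum>M\<in>UNIV. \<Sum>k. p M k) = (\<Sum>k. p {} k) + (\<Sum>M | M \<noteq> {}. \<Sum>k. p M k)"
      by (subst sum.remove[of _ "{}"]) (auto intro!: sum.cong)
    ultimately show "(\<Sum>M\<in>UNIV. \<Sum>k. p M k) = 1"
      by simp
  qed fact
  moreover have "p M k = q M k" if "2 \<le> card M" for M k
    using that by (auto simp: p_def p1_def)
  ultimately show ?thesis
    using that by blast
qed

text \<open>After division by \<open>x\<close> all exponents are positive, so the sum tends to 0.
  With \<open>x\<close> the right end of a shell, \<open>x / 2\<close> is the length of that shell,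
  and one \<open>m\<close> serves all shells at once.\<close>

lemma small_shell_bound:
  fixes A B :: "'i \<Rightarrow> real"
  assumes "finite I" "\<And>i. i \<in> I \<Longrightarrow> 1 < B i"
  obtains m where "n \<le> m" "0 < m"
    "\<And>x. 0 < x \<Longrightarrow> x \<le> 1 / real m \<Longrightarrow> (\<Sum>i\<in>I. A i * x powr B i) \<le> x / 2"
proof -
  have "((\<lambda>x. \<Sum>i\<in>I. A i * x powr (B i - 1)) \<longlongrightarrow> (\<Sum>i\<in>I. 0)) (at_right 0)"
  proof (rule tendsto_sum)
    fix i assume "i \<in> I"
    then have "1 < B i"
      by (rule assms)
    then show "((\<lambda>x. A i * x powr (B i - 1)) \<longlongrightarrow> 0) (at_right 0)"
      by real_asymp
  qed
  then have "\<forall>\<^sub>F x in at_right 0. (\<Sum>i\<in>I. A i * x powr (B i - 1)) < 1 / 2"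
    by (intro order_tendstoD) auto
  then obtain d where d: "0 < d" "\<And>x. 0 < x \<Longrightarrow> x < d \<Longrightarrow> (\<Sum>i\<in>I. A i * x powr (B i - 1)) < 1 / 2"
    unfolding eventually_at_right_field by blast
  obtain m0 where m0: "1 / d < real m0"
    using reals_Archimedean2 by blast
  let ?m = "max (max n 1) m0"
  have "1 / d < real ?m"
    using m0 by simp
  then have m: "1 / real ?m < d"
    using \<open>0 < d\<close> by (simp add: field_simps)
  show ?thesis
  proof
    fix x :: real assume x: "0 < x" "x \<le> 1 / real ?m"
    have "(\<Sum>i\<in>I. A i * x powr B i) = (\<Sum>i\<in>I. A i * x powr (B i - 1)) * x"
      using x by (simp add: sum_distrib_right powr_diff)
    also have "\<dots> \<le> 1 / 2 * x"
      using x m d(2)[of x] by (intro mult_right_mono) auto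
    finally show "(\<Sum>i\<in>I. A i * x powr B i) \<le> x / 2"
      by simp
  qed auto
qed

text \<open>Total mass 1 and uniform marginals make the corner mass equal to
  \<open>s powr card N\<close> for these faces, whatever the weights.\<close>

lemma (in shell_mixture) tchar_cop_trivial:
  assumes "card N \<le> 1"
  shows "tchar cop (front_face N) = (1, ereal (card N))"
proof -
  have "corner_mass (face_marginal (front_face N) cop) s = s powr card N" if s: "0 < s" "s \<le> 1" for s
  proof (cases "N = {}")
    case True
    interpret prob_space cop
      using borel_prob_measure_on_cop by (simp add: borel_prob_measure_on_def)
    show ?thesis
      using True s prob_space corner_mass_face_marginal[OF borel_prob_measure_on_cop s, of N]
      by (simp add: space_cop)
  next
    case False
    with assms have "card N = 1"
      by (simp add: le_Suc_eq card_gt_0_iff)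
    then obtain i where N: "N = {i}"
      by (auto simp: card_1_singleton_iff)
    have "measure cop {u \<in> unit_cube. u $ i \<in> {..s}} = measure lborel ({..s} \<inter> {0..1})"
      by (simp only: measure_def emeasure_cop_coordinate[of "{..s}" i] atMost_borel)
    also have "{..s} \<inter> {0..1} = {0..s}"
      using s by auto
    finally show ?thesis
      using s corner_mass_face_marginal[OF borel_prob_measure_on_cop s, of N] by (simp add: N)
  qed
  then have "\<forall>\<^sub>F s in at_right 0. ereal (corner_mass (face_marginal (front_face N) cop) s / s powr card N) = 1"
    using eventually_at_right_real[of 0 1] by (auto elim!: eventually_mono)
  then have "Liminf (at_right 0) (\<lambda>s. ereal (corner_mass (face_marginal (front_face N) cop) s / s powr card N)) = ereal 1"
    by (subst Liminf_eq[where g="\<lambda>_. 1"]) (auto simp: Liminf_const one_ereal_def)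
  from td_tc_eqI[OF this] show ?thesis
    by (simp add: tchar_def tcoef_def tdeg_def one_ereal_def)
qed

theorem mainTheorem1:
  fixes a b :: "(real ^ 'r) set \<Rightarrow> real"
  assumes "\<forall>F\<in>front_faces. 0 < a F"
    and "\<forall>F\<in>front_faces. 0 \<le> b F"
    and "\<forall>F\<in>front_faces. face_dim F \<le> 1 \<longrightarrow> (a F, b F) = (1, real (face_dim F))"
    and "strict_mono_on front_faces b"
  shows "\<exists>c :: (real ^ 'r) measure.
    copula_measure c \<and>
    (\<forall>F\<in>front_faces. tchar c F = (ereal (a F), ereal (b F))) \<and>
    locally_piecewise_uniform_on (box 0 1) c"
proof -
  define A where "A N = a (front_face N)" for N
  define B where "B N = b (front_face N)" for N
  have A_pos: "0 < A N" for N
    using assms(1) by (auto simp: A_def front_faces_def)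
  have low: "A N = 1" "B N = real (card N)" if "card N \<le> 1" for N
    using assms(3) that by (auto simp: A_def B_def front_faces_def face_dim_front_face)
  have B_mono: "B N < B M" if "N \<subset> M" for N M
  proof -
    have "front_face N \<subset> (front_face M :: (real ^ 'r) set)"
      using that by (simp add: less_le_not_le front_face_mono)
    then show ?thesis
      unfolding B_def by (intro strict_mono_onD[OF assms(4)]) (auto simp: front_faces_def)
  qed
  \<comment> \<open>Strict monotonicity against a singleton contained in \<open>N\<close>, where
    \<open>B\<close> is 1.\<close>
  have B_gt_1: "1 < B N" if "2 \<le> card N" for N
  proof -
    obtain i where "i \<in> N"
      using \<open>2 \<le> card N\<close> by fastforce
    moreover have "N \<noteq> {i}"
      using that by auto
    ultimately have "B {i} < B N"
      by (intro B_mono) auto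
    then show ?thesis
      using low(2)[of "{i}"] by simp
  qed
  \<comment> \<open>The weights will depend on \<open>\<epsilon> = 1 / real m\<close> through
    \<open>shell_tc\<close>. To avoid circularity, \<open>m\<close> is chosen for their bound
    \<open>A N * 2 powr B N\<close>, which is independent of \<open>m\<close>.\<close>
  obtain m where m: "max 2 CARD('r) \<le> m" and
    small: "\<And>x. 0 < x \<Longrightarrow> x \<le> 1 / real m \<Longrightarrow>
      (\<Sum>N | 2 \<le> card N. A N * 2 powr B N * x powr B N) \<le> x / 2"
  proof (rule small_shell_bound)
    show "1 < B N" if "N \<in> {N. 2 \<le> card N}" for N
      using that B_gt_1 by simp
  qed (simp, rule that)
  define \<epsilon> where "\<epsilon> = 1 / real m"
  have "0 < \<epsilon>"
    using m by (simp add: \<epsilon>_def)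
  define C where "C N = shell_tc \<epsilon> (B N) (card N)" for N
  have C_lower: "1 / 2 powr B N \<le> C N" "0 < C N" if "2 \<le> card N" for N
  proof -
    show "1 / 2 powr B N \<le> C N"
      using B_gt_1[OF that] that \<open>0 < \<epsilon>\<close> unfolding C_def by (intro shell_tc_lower) auto
    then show "0 < C N"
      by (rule less_le_trans[rotated]) simp
  qed
  \<comment> \<open>Dividing by the limit inferior \<open>C N\<close> of the normalised shell sum
    makes the leading term at \<open>N\<close> have coefficient \<open>A N\<close>.\<close>
  define P where "P N = (if 2 \<le> card N then A N / C N else 0)" for N
  have P_nonneg: "0 \<le> P N" for N
    using C_lower(2)[of N] A_pos[of N] by (simp add: P_def less_imp_le)
  have P_upper: "P N \<le> A N * 2 powr B N" if "2 \<le> card N" for N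
  proof -
    have "A N / C N \<le> A N / (1 / 2 powr B N)"
      using C_lower[OF that] A_pos[of N] by (intro divide_left_mono) auto
    then show ?thesis
      using that by (simp add: P_def)
  qed
  define q where "q N k = P N * (\<epsilon> / 2 ^ k) powr B N" for N k
  obtain p where "shell_mixture m p" and p: "\<And>M k. 2 \<le> card M \<Longrightarrow> p M k = q M k"
  proof (rule shell_mixture_completion[of m q])
    show "2 \<le> m" "CARD('r) \<le> m"
      using m by auto
    show "0 \<le> q M k" for M k
      by (simp add: q_def P_nonneg)
    show "summable (q M)" if "2 \<le> card M" for M
      unfolding q_def using B_gt_1[OF that] \<open>0 < \<epsilon>\<close> by (intro summable_mult summable_shell_powr) auto
    fix k
    have "(\<Sum>M | 2 \<le> card M. q M k) \<le> (\<Sum>M | 2 \<le> card M. A M * 2 powr B M * (\<epsilon> / 2 ^ k) powr B M)"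
      unfolding q_def by (intro sum_mono mult_right_mono P_upper) auto
    also have "\<dots> \<le> \<epsilon> / 2 ^ k / 2"
      using \<open>0 < \<epsilon>\<close> divide_left_mono[of 1 "2 ^ k" \<epsilon>] by (intro small) (auto simp: \<epsilon>_def)
    finally show "(\<Sum>M | 2 \<le> card M. q M k) \<le> 1 / real m / 2 ^ Suc k"
      by (simp add: \<epsilon>_def mult_ac)
  qed (rule that)
  interpret mix: shell_mixture m p
    by fact
  have mix_\<epsilon>: "mix.\<epsilon> = \<epsilon>"
    by (simp add: mix.\<epsilon>_def \<epsilon>_def)
  have "tchar mix.cop (front_face N) = (ereal (A N), ereal (B N))" for N
  proof (cases "card N \<le> 1")
    case True
    then show ?thesis
      using mix.tchar_cop_trivial[OF True] low[OF True] by (simp add: one_ereal_def)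
  next
    case False
    let ?g = "corner_mass (face_marginal (front_face N) mix.cop)"
    let ?h = "\<lambda>M s. P M * (shell_sum \<epsilon> (B M) (card N) s / s powr B N)"
    let ?S = "{M. N \<subset> M}"
    have N: "2 \<le> card N" "0 < card N"
      using False by auto
    \<comment> \<open>Every set that contributes to the corner of \<open>N\<close> thus has weight
      \<open>q\<close>, which the completion by smaller sets leaves untouched.\<close>
    have card_sup: "2 \<le> card M" if "N \<subseteq> M" for M
      using N card_mono[of M N] that by simp
    have g: "?g s / s powr B N = ?h N s + (\<Sum>M\<in>?S. ?h M s)" if s: "0 < s" "s \<le> \<epsilon>" for s
    proof -
      have "s \<le> 1"
        using s mix.\<epsilon> by (simp add: mix_\<epsilon>)
      then have "?g s = (\<Sum>M | N \<subseteq> M. \<Sum>k. p M k * shell_part \<epsilon> k s ^ card N)"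
        using corner_mass_face_marginal[OF mix.borel_prob_measure_on_cop s(1)] mix.measure_cop_corner[of s N] s
        by (simp add: mix_\<epsilon>)
      also have "\<dots> = (\<Sum>M | N \<subseteq> M. P M * shell_sum \<epsilon> (B M) (card N) s)"
      proof (intro sum.cong refl)
        fix M assume "M \<in> {M. N \<subseteq> M}"
        then have M: "2 \<le> card M"
          using card_sup by simp
        have "(\<Sum>k. P M * ((\<epsilon> / 2 ^ k) powr B M * shell_part \<epsilon> k s ^ card N)) = P M * shell_sum \<epsilon> (B M) (card N) s"
          unfolding shell_sum_def using \<open>0 < \<epsilon>\<close> B_gt_1[OF M] by (intro suminf_mult summable_shell_sum) auto
        then show "(\<Sum>k. p M k * shell_part \<epsilon> k s ^ card N) = P M * shell_sum \<epsilon> (B M) (card N) s"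
          by (simp add: p[OF M] q_def mult.assoc)
      qed
      also have "{M. N \<subseteq> M} = insert N ?S"
        by auto
      finally show ?thesis
        by (simp add: add_divide_distrib sum_divide_distrib)
    qed
    have "Liminf (at_right 0) (\<lambda>s. ereal (?g s / s powr B N))
        = Liminf (at_right 0) (\<lambda>s. ereal (?h N s + (\<Sum>M\<in>?S. ?h M s)))"
    proof (rule Liminf_eq)
      show "\<forall>\<^sub>F s in at_right 0. ereal (?g s / s powr B N) = ereal (?h N s + (\<Sum>M\<in>?S. ?h M s))"
        using eventually_at_right_real[OF \<open>0 < \<epsilon>\<close>] by (rule eventually_mono) (use g in auto)
    qed
    \<comment> \<open>The proper supersets of \<open>N\<close> have strictly larger exponents, so
      their normalised contributions tend to 0.\<close>
    also have "\<dots> = Liminf (at_right 0) (\<lambda>s. ereal (?h N s))"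
    proof (rule Liminf_add_tendsto_0)
      have "((\<lambda>s. \<Sum>M\<in>?S. ?h M s) \<longlongrightarrow> (\<Sum>M\<in>?S. P M * 0)) (at_right 0)"
      proof (intro tendsto_sum tendsto_mult tendsto_const shell_sum_smallo)
        fix M assume "M \<in> ?S"
        then show "B N < B M" "0 < B M"
          using B_mono[of N M] B_gt_1[OF N(1)] by auto
      qed (use \<open>0 < \<epsilon>\<close> N in auto)
      then show "((\<lambda>s. \<Sum>M\<in>?S. ?h M s) \<longlongrightarrow> 0) (at_right 0)"
        by simp
    qed
    also have "\<dots> = ereal (P N) * Liminf (at_right 0) (\<lambda>s. ereal (shell_sum \<epsilon> (B N) (card N) s / s powr B N))"
      unfolding times_ereal.simps(1)[symmetric] using P_nonneg[of N]
      by (intro Liminf_ereal_mult_left) auto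
    also have "\<dots> = ereal (P N) * ereal (C N)"
      using Liminf_shell_sum[of \<epsilon> "B N" "card N"] \<open>0 < \<epsilon>\<close> B_gt_1[OF N(1)] N by (simp add: C_def)
    also have "\<dots> = ereal (A N)"
      using N C_lower(2)[of N] by (simp add: P_def)
    finally have lim: "Liminf (at_right 0) (\<lambda>s. ereal (?g s / s powr B N)) = ereal (A N)" .
    show ?thesis
      using td_tc_eqI[OF lim A_pos[of N]] by (simp add: tchar_def tcoef_def tdeg_def)
  qed
  then show ?thesis
    using mix.copula_measure_cop mix.locally_piecewise_uniform_cop
    by (intro exI[of _ mix.cop]) (auto simp: front_faces_def A_def B_def)
qed

end
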